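(* Let $X$ be a completely regular topological space. Then $$L(X)=\chi([X,\$],X)=t([X,\$],X)=t(T[X,\$],X)=\chi([X,\mathbb{R}])=t([X,\mathbb{R}]).$$
   Context: For families $\mathcal F,\mathcal G$ of subsets of a set, $\mathcal F\le\mathcal G$ means every element of $\mathcal F$ contains an element of $\mathcal G$; $\mathcal F\#\mathcal G$ means $F\cap G\ne\varnothing$ for all $F\in\mathcal F,G\in\mathcal G$. A convergence on a set $Y$ assigns to each filter $\mathcal F$ on $Y$ a set $\lim\mathcal F\subseteq Y$ such that $\mathcal F\le\mathcal G$ implies $\lim\mathcal F\subseteq\lim\mathcal G$, and each principal ultrafilter converges to its point. Topologies are regarded as convergences. For a convergence $\xi$, $T\xi$ is its topological modification: the finest topology coarser than $\xi$ (a set is open for $T\xi$ iff it belongs to every filter that $\xi$-converges to one of its points). $C(X,\$)$ is the set of open subsets of $X$. $[X,\$]$ is the natural convergence on $C(X,\$)$: $Y\in\lim_{[X,\$]}\gamma$ iff $Y\subseteq\bigcup_{\mathcal G\in\gamma}\mathrm{int}_X\bigcap_{G\in\mathcal G}G$. $[X,\mathbb R]$ is the natural (continuous) convergence on $C(X,\mathbb R)$: $f\in\lim_{[X,\mathbb R]}\mathcal F$ iff for every $x\in X$ and open $O\ni f(x)$ there are an open $V\ni x$ and $F\in\mathcal F$ with $g(V)\subseteq O$ for all $g\in F$. $L(X)$ is the Lindelöf degree: the least cardinal $\lambda$ such that every open cover of $X$ has a subcover of cardinality at most $\lambda$. For a convergence space $Y$ and $y\in Y$: the character $\chi(Y,y)$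 is the least $\lambda$ such that whenever $y\in\lim\mathcal F$ there is a filter $\mathcal D\le\mathcal F$ with $y\in\lim\mathcal D$ having a filter base of cardinality at most $\lambda$; the tightness $t(Y,y)$ is the least $\lambda$ such that whenever $y\in\lim\mathcal F$ there is a filter $\mathcal D\le\mathcal F$ with $y\in\lim\mathcal D$ such that for every countably based filter $\mathcal H$ with $\mathcal D\#\mathcal H$ there is a set $A$ of cardinality at most $\lambda$ meeting every element of $\mathcal D\vee\mathcal H$. $\chi(Y)$ and $t(Y)$ are the suprema over $y\in Y$. All cardinal functions are understood to be infinite (at least $\omega$). *)

theory Defs
  imports "HOL-Analysis.Analysis"
begin

unbundle cardinal_syntax
\<comment> \<open>\<open>=o\<close> is reserved for equality of cardinals\<close>
no_notation elt_set_eq (infix "=o" 50)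


section \<open>Filters and convergences\<close>

text \<open>
  A filter on a set \<open>Y\<close> is a proper filter of the ambient type containing \<open>Y\<close>.  The order on
  \<^typ>\<open>'y filter\<close> is opposite to the order on families of sets: \<open>\<D> \<le> \<F>\<close> as families
  (\<open>\<D>\<close> is coarser than \<open>\<F>\<close>) reads \<open>F \<le> D\<close> here, and the join \<open>\<D> \<or> \<H>\<close> is \<open>inf D H\<close>.
\<close>

definition in_filter :: "'y set \<Rightarrow> 'y filter \<Rightarrow> bool"
  where "in_filter A F \<longleftrightarrow> eventually (\<lambda>y. y \<in> A) F"

definition filter_on :: "'y set \<Rightarrow> 'y filter \<Rightarrow> bool"
  where "filter_on Y F \<longleftrightarrow> F \<noteq> bot \<and> in_filter Y F"

definition filter_base :: "'y set set \<Rightarrow> 'y filter \<Rightarrow> bool"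
  where "filter_base \<B> F \<longleftrightarrow> (\<forall>A. in_filter A F \<longleftrightarrow> (\<exists>B\<in>\<B>. B \<subseteq> A))"

definition countably_based :: "'y filter \<Rightarrow> bool"
  where "countably_based F \<longleftrightarrow> (\<exists>\<B>. countable \<B> \<and> filter_base \<B> F)"

definition mesh :: "'y filter \<Rightarrow> 'y filter \<Rightarrow> bool"
  where "mesh F G \<longleftrightarrow> (\<forall>A B. in_filter A F \<and> in_filter B G \<longrightarrow> A \<inter> B \<noteq> {})"

record 'y convergence =
  points :: "'y set"
  lims :: "'y filter \<Rightarrow> 'y set"

text \<open>
  Only the values of \<open>lims \<xi>\<close> on filters on \<open>points \<xi>\<close> are meaningful.
\<close>

definition is_convergence :: "'y convergence \<Rightarrow> bool"
  where "is_convergence \<xi> \<longleftrightarrow>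
    (\<forall>F. filter_on (points \<xi>) F \<longrightarrow> lims \<xi> F \<subseteq> points \<xi>) \<and>
    (\<forall>F G. filter_on (points \<xi>) F \<and> filter_on (points \<xi>) G \<and> G \<le> F \<longrightarrow> lims \<xi> F \<subseteq> lims \<xi> G) \<and>
    (\<forall>y\<in>points \<xi>. y \<in> lims \<xi> (principal {y}))"

definition topology_convergence :: "'y topology \<Rightarrow> 'y convergence"
  where "topology_convergence \<tau> =
    \<lparr>points = topspace \<tau>, lims = (\<lambda>F. {y. limitin \<tau> (\<lambda>z. z) y F})\<rparr>"

definition modification_open :: "'y convergence \<Rightarrow> 'y set \<Rightarrow> bool"
  where "modification_open \<xi> W \<longleftrightarrow> W \<subseteq> points \<xi> \<and>
    (\<forall>F. filter_on (points \<xi>) F \<and> lims \<xi> F \<inter> W \<noteq> {} \<longrightarrow> in_filter W F)"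

definition topological_modification :: "'y convergence \<Rightarrow> 'y topology"
  where "topological_modification \<xi> = topology (modification_open \<xi>)"

definition T_mod :: "'y convergence \<Rightarrow> 'y convergence"
  where "T_mod \<xi> = topology_convergence (topological_modification \<xi>)"


section \<open>The natural convergences on function spaces\<close>

text \<open>The convergence \<open>[X,$]\<close> on the set of open subsets of \<open>X\<close>.\<close>

definition open_sets_convergence :: "'a topology \<Rightarrow> 'a set convergence"
  where "open_sets_convergence X =
    \<lparr>points = {U. openin X U},
     lims = (\<lambda>\<gamma>. {Y. openin X Y \<and> Y \<subseteq> (\<Union>\<G>\<in>{\<G>. in_filter \<G> \<gamma>}. X interior_of (\<Inter>\<G>))})\<rparr>"

text \<open>
  Real functions on \<open>X\<close> are represented by functions on the ambient type that are
  \<open>extensional\<close>, so that each continuous function on \<open>X\<close> has exactly one representative.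
\<close>

definition real_maps_convergence :: "'a topology \<Rightarrow> ('a \<Rightarrow> real) convergence"
  where "real_maps_convergence X =
    \<lparr>points = {f \<in> extensional (topspace X). continuous_map X euclideanreal f},
     lims = (\<lambda>F. {f \<in> extensional (topspace X). continuous_map X euclideanreal f \<and>
        (\<forall>x\<in>topspace X. \<forall>W. open W \<and> f x \<in> W \<longrightarrow>
          (\<exists>V A. openin X V \<and> x \<in> V \<and> in_filter A F \<and> (\<forall>g\<in>A. g ` V \<subseteq> W)))})\<rparr>"


section \<open>Cardinal functions\<close>

text \<open>
  Cardinals are cardinal orders on some type, compared by \<open>\<le>o\<close> and \<open>=o\<close>.  A cardinal function is
  the least infinite cardinal with a given property, determined up to \<open>=o\<close>.  The result type
  \<open>'y set + nat\<close> is infinite and large enough for such a cardinal to exist in each case;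
  the \<open>_is_least\<close> lemmas below establish this, so the choice of type does not matter.
\<close>

definition is_least_card :: "('c rel \<Rightarrow> bool) \<Rightarrow> 'c rel \<Rightarrow> bool"
  where "is_least_card P \<kappa> \<longleftrightarrow>
    Cinfinite \<kappa> \<and> P \<kappa> \<and> (\<forall>\<mu>. Cinfinite \<mu> \<and> P \<mu> \<longrightarrow> \<kappa> \<le>o \<mu>)"

definition least_card :: "('c rel \<Rightarrow> bool) \<Rightarrow> 'c rel"
  where "least_card P = (SOME \<kappa>. is_least_card P \<kappa>)"

definition lindelof_le :: "'a topology \<Rightarrow> 'c rel \<Rightarrow> bool"
  where "lindelof_le X \<kappa> \<longleftrightarrow>
    (\<forall>\<U>. (\<forall>U\<in>\<U>. openin X U) \<and> \<Union>\<U> = topspace X \<longrightarrow>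
       (\<exists>\<V>. \<V> \<subseteq> \<U> \<and> \<Union>\<V> = topspace X \<and> |\<V>| \<le>o \<kappa>))"

definition character_at_le :: "'y convergence \<Rightarrow> 'y \<Rightarrow> 'c rel \<Rightarrow> bool"
  where "character_at_le \<xi> y \<kappa> \<longleftrightarrow>
    (\<forall>F. filter_on (points \<xi>) F \<and> y \<in> lims \<xi> F \<longrightarrow>
       (\<exists>D. filter_on (points \<xi>) D \<and> F \<le> D \<and> y \<in> lims \<xi> D \<and>
          (\<exists>\<B>. filter_base \<B> D \<and> |\<B>| \<le>o \<kappa>)))"

definition tightness_at_le :: "'y convergence \<Rightarrow> 'y \<Rightarrow> 'c rel \<Rightarrow> bool"
  where "tightness_at_le \<xi> y \<kappa> \<longleftrightarrow>
    (\<forall>F. filter_on (points \<xi>) F \<and> y \<in> lims \<xi> F \<longrightarrow>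
       (\<exists>D. filter_on (points \<xi>) D \<and> F \<le> D \<and> y \<in> lims \<xi> D \<and>
          (\<forall>H. filter_on (points \<xi>) H \<and> countably_based H \<and> mesh D H \<longrightarrow>
             (\<exists>A. A \<subseteq> points \<xi> \<and> |A| \<le>o \<kappa> \<and> (\<forall>B. in_filter B (inf D H) \<longrightarrow> A \<inter> B \<noteq> {})))))"

definition lindelof_degree :: "'a topology \<Rightarrow> ('a set + nat) rel"
  where "lindelof_degree X = least_card (lindelof_le X)"

definition character_at :: "'y convergence \<Rightarrow> 'y \<Rightarrow> ('y set + nat) rel"
  where "character_at \<xi> y = least_card (character_at_le \<xi> y)"

definition tightness_at :: "'y convergence \<Rightarrow> 'y \<Rightarrow> ('y set + nat) rel"
  where "tightness_at \<xi> y = least_card (tightness_at_le \<xi> y)"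

definition character :: "'y convergence \<Rightarrow> ('y set + nat) rel"
  where "character \<xi> = least_card (\<lambda>\<kappa>. \<forall>y\<in>points \<xi>. character_at \<xi> y \<le>o \<kappa>)"

definition tightness :: "'y convergence \<Rightarrow> ('y set + nat) rel"
  where "tightness \<xi> = least_card (\<lambda>\<kappa>. \<forall>y\<in>points \<xi>. tightness_at \<xi> y \<le>o \<kappa>)"


section \<open>Well-definedness\<close>

lemma istopology_modification_open: "istopology (modification_open \<xi>)"
  unfolding istopology_def
proof (intro conjI allI impI)
  fix S T assume ST: "modification_open \<xi> S" "modification_open \<xi> T"
  show "modification_open \<xi> (S \<inter> T)"
    unfolding modification_open_def
  proof (intro conjI allI impI)
    show "S \<inter> T \<subseteq> points \<xi>" using ST by (auto simp: modification_open_def)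
    fix F assume F: "filter_on (points \<xi>) F \<and> lims \<xi> F \<inter> (S \<inter> T) \<noteq> {}"
    then have "in_filter S F" "in_filter T F"
      using ST unfolding modification_open_def by blast+
    then show "in_filter (S \<inter> T) F"
      by (simp add: in_filter_def eventually_conj_iff)
  qed
next
  fix \<K> assume K: "\<forall>S\<in>\<K>. modification_open \<xi> S"
  show "modification_open \<xi> (\<Union>\<K>)"
    unfolding modification_open_def
  proof (intro conjI allI impI)
    show "\<Union>\<K> \<subseteq> points \<xi>" using K by (auto simp: modification_open_def)
    fix F assume F: "filter_on (points \<xi>) F \<and> lims \<xi> F \<inter> \<Union>\<K> \<noteq> {}"
    then obtain S where S: "S \<in> \<K>" "in_filter S F"
      using K unfolding modification_open_def by blast
    then show "in_filter (\<Union>\<K>) F"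
      unfolding in_filter_def by (auto elim: eventually_mono)
  qed
qed

lemma openin_topological_modification:
  "openin (topological_modification \<xi>) W \<longleftrightarrow> modification_open \<xi> W"
  by (simp add: topological_modification_def istopology_modification_open topology_inverse')

lemma topspace_topological_modification:
  assumes "is_convergence \<xi>"
  shows "topspace (topological_modification \<xi>) = points \<xi>"
proof -
  have "modification_open \<xi> (points \<xi>)"
    by (simp add: modification_open_def filter_on_def)
  then show ?thesis
    by (meson modification_open_def openin_subset openin_topological_modification
        openin_topspace subset_antisym)
qed

lemma is_convergence_topology_convergence: "is_convergence (topology_convergence \<tau>)"
  by (auto simp: is_convergence_def topology_convergence_def limitin_def le_filter_def
      eventually_principal)

lemma is_convergence_open_sets_convergence: "is_convergence (open_sets_convergence X)"
proof -
  have "Y \<subseteq> (\<Union>\<G>\<in>{\<G>. in_filter \<G> (principal {Y})}. X interior_of (\<Inter>\<G>))" if "openin X Y" for Y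
  proof -
    have "in_filter {Y} (principal {Y})"
      by (simp add: in_filter_def eventually_principal)
    then show ?thesis using that by (auto simp: interior_of_openin intro!: exI[of _ "{Y}"])
  qed
  then show ?thesis
    unfolding is_convergence_def open_sets_convergence_def convergence.simps
  proof (intro conjI allI impI ballI subsetI, goal_cases)
    case (2 F G Y)
    have "{\<G>. in_filter \<G> F} \<subseteq> {\<G>. in_filter \<G> G}"
      using 2 by (auto simp: in_filter_def le_filter_def)
    then have "(\<Union>\<G>\<in>{\<G>. in_filter \<G> F}. X interior_of (\<Inter>\<G>))
        \<subseteq> (\<Union>\<G>\<in>{\<G>. in_filter \<G> G}. X interior_of (\<Inter>\<G>))"
      by (rule UN_mono) simp
    then show ?case
      using 2(3) by (blast intro: subset_trans)
  qed auto
qed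

lemma is_convergence_real_maps_convergence: "is_convergence (real_maps_convergence X)"
proof -
  have "\<exists>V A. openin X V \<and> x \<in> V \<and> in_filter A (principal {f}) \<and> (\<forall>g\<in>A. g ` V \<subseteq> W)"
    if f: "continuous_map X euclideanreal f" and x: "x \<in> topspace X" and W: "open W" "f x \<in> W"
    for f :: "'a \<Rightarrow> real" and x W
  proof (intro exI conjI)
    show "openin X {z \<in> topspace X. f z \<in> W}"
      using f W(1) by (simp add: continuous_map_def)
    show "in_filter {f} (principal {f})"
      by (simp add: in_filter_def eventually_principal)
  qed (use x W in auto)
  note principal = this
  show ?thesis
    unfolding is_convergence_def real_maps_convergence_def convergence.simps
  proof (intro conjI allI impI ballI, goal_cases)
    case (2 F G)
    then have "in_filter A G" if "in_filter A F" for A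
      using that by (auto simp: in_filter_def le_filter_def)
    then show ?case by blast
  next
    case (3 f)
    then show ?case using principal by simp
  qed blast
qed

lemma least_card_is_least:
  assumes "Cinfinite \<mu>" "P \<mu>"
  shows "is_least_card P (least_card P)"
proof -
  have "\<exists>\<kappa>\<in>{\<mu>. Cinfinite \<mu> \<and> P \<mu>}. \<forall>\<mu>\<in>{\<mu>. Cinfinite \<mu> \<and> P \<mu>}. \<kappa> \<le>o \<mu>"
    using assms by (intro exists_minim_Card_order) auto
  then have "\<exists>\<kappa>. is_least_card P \<kappa>"
    by (auto simp: is_least_card_def)
  then show ?thesis
    unfolding least_card_def by (rule someI_ex)
qed

lemma Cinfinite_UNIV_sum_nat: "Cinfinite |UNIV :: ('c + nat) set|"
proof -
  have "infinite (UNIV :: ('c + nat) set)"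
    by simp
  then have "cinfinite |UNIV :: ('c + nat) set|"
    unfolding cinfinite_def Field_card_of .
  then show ?thesis
    using card_of_Card_order by (rule conjI)
qed

lemma card_of_le_UNIV_sum_nat: "|A :: 'c set| \<le>o |UNIV :: ('c + nat) set|"
  by (rule card_of_ordLeqI[of Inl]) auto

lemma lindelof_degree_is_least: "is_least_card (lindelof_le X) (lindelof_degree X)"
  unfolding lindelof_degree_def
proof (rule least_card_is_least[OF Cinfinite_UNIV_sum_nat])
  show "lindelof_le X |UNIV :: ('a set + nat) set|"
    unfolding lindelof_le_def by (meson card_of_le_UNIV_sum_nat subset_refl)
qed

lemma character_at_is_least:
  fixes \<xi> :: "'b convergence"
  shows "is_least_card (character_at_le \<xi> y) (character_at \<xi> y)"
  unfolding character_at_def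
proof (rule least_card_is_least[OF Cinfinite_UNIV_sum_nat])
  have "filter_base {A. in_filter A F} F" for F :: "'b filter"
    unfolding filter_base_def in_filter_def by (auto elim: eventually_mono)
  then have "\<exists>\<B>. filter_base \<B> F \<and> |\<B>| \<le>o |UNIV :: ('b set + nat) set|" for F :: "'b filter"
    using card_of_le_UNIV_sum_nat by metis
  then show "character_at_le \<xi> y |UNIV :: ('b set + nat) set|"
    unfolding character_at_le_def by (intro allI impI) (blast intro: order_refl)
qed

lemma tightness_at_is_least:
  fixes \<xi> :: "'b convergence"
  shows "is_least_card (tightness_at_le \<xi> y) (tightness_at \<xi> y)"
  unfolding tightness_at_def
proof (rule least_card_is_least[OF Cinfinite_UNIV_sum_nat])
  have card: "|A| \<le>o |UNIV :: ('b set + nat) set|" for A :: "'b set"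
    by (rule card_of_ordLeqI[of "\<lambda>x. Inl {x}"]) (auto simp: inj_on_def)
  have meets: "points \<xi> \<inter> B \<noteq> {}"
    if D: "filter_on (points \<xi>) D" and m: "mesh D H" and B: "in_filter B (inf D H)" for D H B
  proof -
    obtain P Q where PQ: "eventually P D" "eventually Q H" "\<And>x. P x \<and> Q x \<Longrightarrow> x \<in> B"
      using B unfolding in_filter_def eventually_inf by blast
    have "in_filter (points \<xi> \<inter> Collect P) D" "in_filter (Collect Q) H"
      using D PQ by (simp_all add: filter_on_def in_filter_def eventually_conj_iff)
    then have "points \<xi> \<inter> Collect P \<inter> Collect Q \<noteq> {}"
      using m unfolding mesh_def by blast
    then show ?thesis using PQ(3) by blast
  qed
  show "tightness_at_le \<xi> y |UNIV :: ('b set + nat) set|"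
    unfolding tightness_at_le_def
  proof (intro allI impI, goal_cases)
    case (1 F)
    have "\<exists>A. A \<subseteq> points \<xi> \<and> |A| \<le>o |UNIV :: ('b set + nat) set| \<and>
        (\<forall>B. in_filter B (inf F H) \<longrightarrow> A \<inter> B \<noteq> {})" if "mesh F H" for H
      using 1 that by (intro exI[of _ "points \<xi>"]) (use meets card in blast)
    then show ?case
      using 1 by blast
  qed
qed

lemma least_card_le_UNIV:
  fixes \<kappa> :: "('c + nat) rel"
  assumes "is_least_card P \<kappa>"
  shows "\<kappa> \<le>o |UNIV :: ('c + nat) set|"
proof -
  have "\<kappa> =o |Field \<kappa>|"
    using assms by (auto simp: is_least_card_def intro: ordIso_symmetric card_of_Field_ordIso)
  then show ?thesis
    using card_of_mono1[of "Field \<kappa>" UNIV] ordIso_ordLeq_trans by blast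
qed

lemma character_is_least:
  "is_least_card (\<lambda>\<kappa>. \<forall>y\<in>points \<xi>. character_at \<xi> y \<le>o \<kappa>) (character \<xi>)"
  unfolding character_def
  by (rule least_card_is_least[OF Cinfinite_UNIV_sum_nat])
    (auto intro: least_card_le_UNIV[OF character_at_is_least])

lemma tightness_is_least:
  "is_least_card (\<lambda>\<kappa>. \<forall>y\<in>points \<xi>. tightness_at \<xi> y \<le>o \<kappa>) (tightness \<xi>)"
  unfolding tightness_def
  by (rule least_card_is_least[OF Cinfinite_UNIV_sum_nat])
    (auto intro: least_card_le_UNIV[OF tightness_at_is_least])

end

theory Submission
  imports Defs
begin

text \<open>
  Every cardinal function here is the least infinite cardinal with some property, so it is enough
  to show that all these properties, taken at an arbitrary infinite \<open>\<kappa>\<close>, are equivalent to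
  \<open>lindelof_le X \<kappa>\<close>.  Since \<open>\<kappa>\<close> may live on any type, this also compares cardinal functions
  with values on different types.

  From covers to functions.  Convergence of a filter to \<open>X\<close> in \<open>[X,$]\<close>, or to \<open>f\<close> in
  \<open>[X,\<real>]\<close>, is witnessed near each point of \<open>X\<close> by one member of the filter (for \<open>[X,\<real>]\<close>,
  by one for every precision \<open>1/n\<close>).  The neighbourhoods involved cover \<open>X\<close>; after passing to a
  subcover of size \<open>\<kappa>\<close>, the chosen members generate a coarser filter that still converges and
  has a base of size \<open>\<kappa>\<close>.  So the character is at most \<open>\<kappa>\<close>, and with it the tightness,
  because a base of size \<open>\<kappa>\<close> can be met, together with a countable one, by \<open>\<kappa>\<close> many points.

  From functions to covers.  Given an open cover \<open>\<U>\<close>, call an open set small if finitely many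
  members of \<open>\<U>\<close> cover it.  The families of all open sets containing a given member of \<open>\<U>\<close>
  generate a filter which converges to \<open>X\<close>, and every member of this filter contains a small set.
  Tightness, tested against the principal filter of the small sets, yields \<open>\<kappa>\<close> many small sets
  that meet all members of a filter converging to \<open>X\<close>.  As such a filter contains
  \<open>{Y. x \<in> Y}\<close> for each \<open>x\<close>, these small sets cover \<open>X\<close>, and the finitely many members of
  \<open>\<U>\<close> behind each of them form a subcover of size \<open>\<kappa>\<close>.  The sets \<open>{Y. x \<in> Y}\<close> are open in
  \<open>T[X,$]\<close>, so the argument serves that topology as well.  In \<open>[X,\<real>]\<close> a function \<open>g\<close> near
  \<open>0\<close> plays the part of the open set \<open>{x. g x < 1}\<close>, and complete regularity supplies enough
  such functions.  The common core of the three cases is \<open>lindelof_le_if_tightness_at_le\<close>.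

  The remaining implication, from \<open>lindelof_le X \<kappa>\<close> to the tightness of \<open>T[X,$]\<close> at \<open>X\<close>, is
  the delicate one, since closures in \<open>T[X,$]\<close> are not obtained from limits in one step and the
  open subsets of \<open>X\<close> may have a large Lindelof degree.  Open sets of \<open>T[X,$]\<close> are the compact
  families of open sets (\<open>modification_open_open_sets_iff\<close>), and by complete regularity the open
  subsets of \<open>X\<close> with Lindelof degree at most \<open>\<kappa>\<close> form a base of \<open>X\<close> that has \<open>X\<close> as a
  member.  Working only with this base, one separates \<open>X\<close> from any family \<open>\<B>\<close> none of whose
  subfamilies of size \<open>\<kappa>\<close> has \<open>X\<close> in its closure
  (\<open>small_subset_with_topspace_in_closure\<close>).
\<close>

section \<open>Infinite cardinals as bounds\<close>

lemma countable_ordLeq_Cinfinite: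
  assumes "Cinfinite \<kappa>" "countable A"
  shows "|A| \<le>o \<kappa>"
proof -
  have "|A| \<le>o |UNIV :: nat set|"
    using assms(2) unfolding countable_def by (blast intro: card_of_ordLeqI)
  then show ?thesis
    using assms(1) card_of_nat natLeq_ordLeq_cinfinite ordIso_ordLeq_trans ordLeq_transitive
    by blast
qed

lemma finite_ordLeq_Cinfinite: "Cinfinite \<kappa> \<Longrightarrow> finite A \<Longrightarrow> |A| \<le>o \<kappa>"
  by (simp add: countable_ordLeq_Cinfinite countable_finite)

lemma image_ordLeq: "|A| \<le>o \<kappa> \<Longrightarrow> |f ` A| \<le>o \<kappa>"
  using card_of_image ordLeq_transitive by blast

lemma subset_ordLeq: "A \<subseteq> B \<Longrightarrow> |B| \<le>o \<kappa> \<Longrightarrow> |A| \<le>o \<kappa>"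
  using card_of_mono1 ordLeq_transitive by blast

lemma Times_Cinfinite_bound:
  assumes "Cinfinite \<kappa>" "|A| \<le>o \<kappa>" "|B| \<le>o \<kappa>"
  shows "|A \<times> B| \<le>o \<kappa>"
  using assms card_of_Times_ordLeq_infinite_Field unfolding cinfinite_def by blast

lemma UN_Cinfinite_bound:
  assumes "Cinfinite \<kappa>" "|I| \<le>o \<kappa>" "\<And>i. i \<in> I \<Longrightarrow> |A i| \<le>o \<kappa>"
  shows "|\<Union>i\<in>I. A i| \<le>o \<kappa>"
  using assms UNION_Cinfinite_bound[of I \<kappa> A] by blast

lemma Fpow_Cinfinite_bound:
  assumes "Cinfinite \<kappa>" "|S| \<le>o \<kappa>"
  shows "|Fpow S| \<le>o \<kappa>"
proof -
  define P where "P n = {F. F \<subseteq> S \<and> finite F \<and> card F = n}" for n :: nat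
  have "|P n| \<le>o \<kappa>" for n
  proof (induction n)
    case 0
    have "P 0 \<subseteq> {{}}" by (auto simp: P_def)
    then show ?case
      using assms(1) finite_ordLeq_Cinfinite finite_subset by blast
  next
    case (Suc n)
    have "F \<in> (\<lambda>(x, F). insert x F) ` (S \<times> P n)" if F: "F \<in> P (Suc n)" for F
    proof -
      obtain x F' where F': "F = insert x F'" "x \<notin> F'" "card F' = n"
        using F card_Suc_eq[of F n] by (auto simp: P_def)
      then have "(x, F') \<in> S \<times> P n"
        using F by (auto simp: P_def)
      then show ?thesis using F'(1) by force
    qed
    then have "P (Suc n) \<subseteq> (\<lambda>(x, F). insert x F) ` (S \<times> P n)" by blast
    then show ?case
      by (rule subset_ordLeq) (intro image_ordLeq Times_Cinfinite_bound assms Suc.IH)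
  qed
  then have "|\<Union>n. P n| \<le>o \<kappa>"
    by (intro UN_Cinfinite_bound[OF assms(1) countable_ordLeq_Cinfinite[OF assms(1)]]) auto
  moreover have "Fpow S \<subseteq> (\<Union>n. P n)"
    by (auto simp: Fpow_def P_def)
  ultimately show ?thesis
    by (rule subset_ordLeq[rotated])
qed

text \<open>
  \<open>P\<close> and \<open>Q\<close> are meant to be the same property at two types.  Leastness only speaks about
  cardinals on the type of \<open>\<nu>\<close>; it reaches any \<open>\<kappa>\<close> because \<open>\<kappa>\<close> either is at least as large
  as that whole type or is equal to a cardinal on it.
\<close>

lemma least_card_ordLeq_iff:
  fixes \<nu> :: "('c + nat) rel" and \<kappa> :: "'d rel"
  assumes least: "is_least_card P \<nu>" and \<kappa>: "Cinfinite \<kappa>"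
    and up: "\<nu> \<le>o \<kappa> \<Longrightarrow> P \<nu> \<Longrightarrow> Q \<kappa>"
    and down: "\<And>\<mu> :: ('c + nat) rel. \<kappa> \<le>o \<mu> \<Longrightarrow> Q \<kappa> \<Longrightarrow> P \<mu>"
  shows "\<nu> \<le>o \<kappa> \<longleftrightarrow> Q \<kappa>"
proof
  assume "\<nu> \<le>o \<kappa>"
  then show "Q \<kappa>"
    using up least by (simp add: is_least_card_def)
next
  assume Q: "Q \<kappa>"
  let ?U = "|UNIV :: ('c + nat) set|"
  have card: "Card_order \<kappa>" "Card_order ?U"
    using \<kappa> by (simp_all add: card_of_Card_order)
  show "\<nu> \<le>o \<kappa>"
  proof (cases "?U \<le>o \<kappa>")
    case True
    then show ?thesis
      by (rule ordLeq_transitive[OF least_card_le_UNIV[OF least]])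
  next
    case False
    \<comment> \<open>Then \<open>\<kappa>\<close> has a copy on a subset of the type of \<open>\<nu>\<close>, where \<open>\<nu>\<close> is least.\<close>
    then have "\<kappa> \<le>o ?U"
      using card ordLeq_total[of ?U \<kappa>] by (auto simp: card_order_on_def)
    then have "|Field \<kappa>| \<le>o ?U"
      by (rule ordIso_ordLeq_trans[OF card_of_Field_ordIso[OF card(1)]])
    then have "\<exists>B \<le> (UNIV :: ('c + nat) set). |Field \<kappa>| =o |B| \<and> |B| \<le>o ?U"
      by (rule iffD1[OF internalize_card_of_ordLeq2])
    then obtain B :: "('c + nat) set" where "|Field \<kappa>| =o |B|"
      by blast
    then have B: "\<kappa> =o |B|"
      by (rule ordIso_transitive[OF ordIso_symmetric[OF card_of_Field_ordIso[OF card(1)]]])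
    have "P |B|"
      by (rule down[OF ordIso_imp_ordLeq[OF B] Q])
    moreover have "Cinfinite |B|"
      using Cinfinite_cong[OF B \<kappa>] .
    ultimately have "\<nu> \<le>o |B|"
      using least by (simp add: is_least_card_def)
    then show ?thesis
      by (rule ordLeq_ordIso_trans[OF _ ordIso_symmetric[OF B]])
  qed
qed

lemma lindelof_le_mono: "\<kappa> \<le>o \<mu> \<Longrightarrow> lindelof_le X \<kappa> \<Longrightarrow> lindelof_le X \<mu>"
  unfolding lindelof_le_def by (meson ordLeq_transitive)

lemma character_at_le_mono: "\<kappa> \<le>o \<mu> \<Longrightarrow> character_at_le \<xi> y \<kappa> \<Longrightarrow> character_at_le \<xi> y \<mu>"
  unfolding character_at_le_def by (meson ordLeq_transitive)

lemma tightness_at_le_mono: "\<kappa> \<le>o \<mu> \<Longrightarrow> tightness_at_le \<xi> y \<kappa> \<Longrightarrow> tightness_at_le \<xi> y \<mu>"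
  unfolding tightness_at_le_def
  by (elim all_forward imp_forward ex_forward conj_forward;
      (assumption | erule ordLeq_transitive, assumption))

lemma lindelof_degree_ordLeq_iff:
  "Cinfinite \<kappa> \<Longrightarrow> lindelof_degree X \<le>o \<kappa> \<longleftrightarrow> lindelof_le X \<kappa>"
  by (rule least_card_ordLeq_iff[OF lindelof_degree_is_least]) (auto intro: lindelof_le_mono)

lemma character_at_ordLeq_iff:
  "Cinfinite \<kappa> \<Longrightarrow> character_at \<xi> y \<le>o \<kappa> \<longleftrightarrow> character_at_le \<xi> y \<kappa>"
  by (rule least_card_ordLeq_iff[OF character_at_is_least]) (auto intro: character_at_le_mono)

lemma tightness_at_ordLeq_iff:
  "Cinfinite \<kappa> \<Longrightarrow> tightness_at \<xi> y \<le>o \<kappa> \<longleftrightarrow> tightness_at_le \<xi> y \<kappa>"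
  by (rule least_card_ordLeq_iff[OF tightness_at_is_least]) (auto intro: tightness_at_le_mono)

lemma character_ordLeq_iff:
  assumes "Cinfinite \<kappa>"
  shows "character \<xi> \<le>o \<kappa> \<longleftrightarrow> (\<forall>y\<in>points \<xi>. character_at_le \<xi> y \<kappa>)"
proof -
  have "character \<xi> \<le>o \<kappa> \<longleftrightarrow> (\<forall>y\<in>points \<xi>. character_at \<xi> y \<le>o \<kappa>)"
    by (rule least_card_ordLeq_iff[OF character_is_least assms]) (blast intro: ordLeq_transitive)+
  then show ?thesis
    by (simp add: character_at_ordLeq_iff[OF assms])
qed

lemma tightness_ordLeq_iff:
  assumes "Cinfinite \<kappa>"
  shows "tightness \<xi> \<le>o \<kappa> \<longleftrightarrow> (\<forall>y\<in>points \<xi>. tightness_at_le \<xi> y \<kappa>)"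
proof -
  have "tightness \<xi> \<le>o \<kappa> \<longleftrightarrow> (\<forall>y\<in>points \<xi>. tightness_at \<xi> y \<le>o \<kappa>)"
    by (rule least_card_ordLeq_iff[OF tightness_is_least assms]) (blast intro: ordLeq_transitive)+
  then show ?thesis
    by (simp add: tightness_at_ordLeq_iff[OF assms])
qed

section \<open>Generated filters\<close>

definition generated_filter :: "'y set set \<Rightarrow> 'y filter"
  where "generated_filter \<G> = (INF G\<in>\<G>. principal G)"

lemma in_filter_mono: "in_filter A F \<Longrightarrow> A \<subseteq> B \<Longrightarrow> in_filter B F"
  unfolding in_filter_def by (auto elim: eventually_mono)

lemma in_filter_le: "F \<le> D \<Longrightarrow> in_filter A D \<Longrightarrow> in_filter A F"
  unfolding in_filter_def le_filter_def by blast

lemma in_filter_Int: "in_filter A F \<Longrightarrow> in_filter B F \<Longrightarrow> in_filter (A \<inter> B) F"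
  by (simp add: in_filter_def eventually_conj_iff)

lemma in_filter_principal [simp]: "in_filter A (principal S) \<longleftrightarrow> S \<subseteq> A"
  by (auto simp: in_filter_def eventually_principal)

lemma filter_le_iff: "F \<le> D \<longleftrightarrow> (\<forall>A. in_filter A D \<longrightarrow> in_filter A F)"
proof
  assume *: "\<forall>A. in_filter A D \<longrightarrow> in_filter A F"
  show "F \<le> D"
  proof (rule filter_leI)
    fix P assume "eventually P D"
    then show "eventually P F"
      using *[rule_format, of "Collect P"] by (simp add: in_filter_def)
  qed
qed (auto intro: in_filter_le)

lemma bot_iff_in_filter_empty: "F = bot \<longleftrightarrow> in_filter {} F"
  by (simp add: in_filter_def eventually_False)

lemma in_filter_Inter:
  "finite \<E> \<Longrightarrow> (\<And>G. G \<in> \<E> \<Longrightarrow> in_filter G F) \<Longrightarrow> in_filter (\<Inter>\<E>) F"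
proof (induction rule: finite_induct)
  case empty
  then show ?case by (simp add: in_filter_def)
next
  case (insert G \<E>)
  then show ?case by (simp add: in_filter_Int)
qed

lemma in_generated_filter:
  "in_filter A (generated_filter \<G>) \<longleftrightarrow> (\<exists>\<E>\<subseteq>\<G>. finite \<E> \<and> \<Inter>\<E> \<subseteq> A)"
proof -
  have "in_filter A (generated_filter \<G>) \<longleftrightarrow>
      (\<exists>\<E>\<subseteq>\<G>. finite \<E> \<and> eventually (\<lambda>y. y \<in> A) (INF G\<in>\<E>. principal G))"
    unfolding in_filter_def generated_filter_def by (rule eventually_INF)
  also have "\<dots> \<longleftrightarrow> (\<exists>\<E>\<subseteq>\<G>. finite \<E> \<and> \<Inter>\<E> \<subseteq> A)"
  proof -
    have "eventually (\<lambda>y. y \<in> A) (INF G\<in>\<E>. principal G) \<longleftrightarrow> \<Inter>\<E> \<subseteq> A" if "finite \<E>" for \<E>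
      using INF_principal_finite[OF that, of "\<lambda>G. G"] by (auto simp: eventually_principal)
    then show ?thesis by blast
  qed
  finally show ?thesis .
qed

lemma in_generated_filterI: "G \<in> \<G> \<Longrightarrow> G \<subseteq> A \<Longrightarrow> in_filter A (generated_filter \<G>)"
  unfolding in_generated_filter by (rule exI[of _ "{G}"]) auto

lemma le_generated_filter:
  "(\<And>G. G \<in> \<G> \<Longrightarrow> in_filter G F) \<Longrightarrow> F \<le> generated_filter \<G>"
  unfolding filter_le_iff in_generated_filter by (meson in_filter_Inter in_filter_mono subsetD)

lemma filter_on_generated_filter:
  assumes "p \<in> \<Inter>\<G>" "Y \<in> \<G>"
  shows "filter_on Y (generated_filter \<G>)"
proof -
  have "\<not> in_filter {} (generated_filter \<G>)"
    using assms(1) by (fastforce simp: in_generated_filter)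
  then show ?thesis
    using assms(2) by (auto simp: filter_on_def bot_iff_in_filter_empty intro: in_generated_filterI)
qed

text \<open>
  Closing \<open>\<kappa>\<close> many members of a filter under finite intersections keeps their number at most
  \<open>\<kappa>\<close>.  This is how a small cover is turned into a filter with a small base.
\<close>

lemma small_coarser_filter:
  assumes \<kappa>: "Cinfinite \<kappa>" and F: "filter_on Y F"
    and \<G>: "\<And>G. G \<in> \<G> \<Longrightarrow> in_filter G F" "|\<G>| \<le>o \<kappa>"
  obtains D where "filter_on Y D" "F \<le> D" "\<And>G. G \<in> \<G> \<Longrightarrow> in_filter G D"
    "\<exists>\<B>. filter_base \<B> D \<and> |\<B>| \<le>o \<kappa>"
proof
  let ?D = "generated_filter (insert Y \<G>)"
  show le: "F \<le> ?D"
    using F \<G>(1) by (intro le_generated_filter) (auto simp: filter_on_def)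
  show "filter_on Y ?D"
    unfolding filter_on_def
  proof
    show "?D \<noteq> bot"
      using F le by (metis bot_unique filter_on_def)
    show "in_filter Y ?D"
      by (rule in_generated_filterI[of Y]) auto
  qed
  show "in_filter G ?D" if "G \<in> \<G>" for G
    using that by (intro in_generated_filterI[of G]) auto
  have "|{Y} \<union> \<G>| \<le>o \<kappa>"
    using \<kappa> \<G>(2) by (intro card_of_Un_ordLeq_infinite_Field)
      (simp_all add: cinfinite_def finite_ordLeq_Cinfinite)
  then have "|Inter ` Fpow (insert Y \<G>)| \<le>o \<kappa>"
    using \<kappa> by (intro image_ordLeq Fpow_Cinfinite_bound) auto
  moreover have "filter_base (Inter ` Fpow (insert Y \<G>)) ?D"
    unfolding filter_base_def in_generated_filter by (auto simp: Fpow_def)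
  ultimately show "\<exists>\<B>. filter_base \<B> ?D \<and> |\<B>| \<le>o \<kappa>"
    by (intro exI[of _ "Inter ` Fpow (insert Y \<G>)"] conjI)
qed

section \<open>Character and tightness of convergences\<close>

lemma tightness_at_le_if_character_at_le:
  assumes \<kappa>: "Cinfinite \<kappa>" and char: "character_at_le \<xi> y \<kappa>"
  shows "tightness_at_le \<xi> y \<kappa>"
  unfolding tightness_at_le_def
proof (intro allI impI)
  fix F assume "filter_on (points \<xi>) F \<and> y \<in> lims \<xi> F"
  then obtain D \<B> where D: "filter_on (points \<xi>) D" "F \<le> D" "y \<in> lims \<xi> D"
      and \<B>: "filter_base \<B> D" "|\<B>| \<le>o \<kappa>"
    using char unfolding character_at_le_def by blast
  have meets: "\<exists>A\<subseteq>points \<xi>. |A| \<le>o \<kappa> \<and> (\<forall>B. in_filter B (inf D H) \<longrightarrow> A \<inter> B \<noteq> {})"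
    if H: "filter_on (points \<xi>) H" "countably_based H" "mesh D H" for H
  proof -
    obtain \<C> where \<C>: "countable \<C>" "filter_base \<C> H"
      using H(2) unfolding countably_based_def by blast
    have "\<exists>p. p \<in> points \<xi> \<inter> B \<inter> C" if "B \<in> \<B>" "C \<in> \<C>" for B C
    proof -
      have "in_filter B D" "in_filter C H"
        using that \<B>(1) \<C>(2) unfolding filter_base_def by blast+
      then have "in_filter (points \<xi> \<inter> B) D" "in_filter C H"
        using D(1) by (simp_all add: filter_on_def in_filter_Int)
      then show ?thesis
        using H(3) unfolding mesh_def by blast
    qed
    then obtain p where p: "\<And>B C. B \<in> \<B> \<Longrightarrow> C \<in> \<C> \<Longrightarrow> p B C \<in> points \<xi> \<inter> B \<inter> C"
      by metis
    let ?A = "(\<lambda>(B, C). p B C) ` (\<B> \<times> \<C>)"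
    have "|?A| \<le>o \<kappa>"
      by (intro image_ordLeq Times_Cinfinite_bound[OF \<kappa> \<B>(2)]
          countable_ordLeq_Cinfinite[OF \<kappa> \<C>(1)])
    moreover have "?A \<inter> E \<noteq> {}" if E: "in_filter E (inf D H)" for E
    proof -
      obtain P Q where PQ: "eventually P D" "eventually Q H" "\<And>z. P z \<and> Q z \<Longrightarrow> z \<in> E"
        using E unfolding in_filter_def eventually_inf by blast
      then have "in_filter (Collect P) D" "in_filter (Collect Q) H"
        by (simp_all add: in_filter_def)
      then obtain B C where BC: "B \<in> \<B>" "B \<subseteq> Collect P" "C \<in> \<C>" "C \<subseteq> Collect Q"
        using \<B>(1) \<C>(2) unfolding filter_base_def by blast
      then have "p B C \<in> E"
        using p[of B C] PQ(3)[of "p B C"] by blast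
      then show ?thesis
        using BC by auto
    qed
    moreover have "?A \<subseteq> points \<xi>"
      using p by auto
    ultimately show ?thesis by blast
  qed
  show "\<exists>D. filter_on (points \<xi>) D \<and> F \<le> D \<and> y \<in> lims \<xi> D \<and>
      (\<forall>H. filter_on (points \<xi>) H \<and> countably_based H \<and> mesh D H \<longrightarrow>
        (\<exists>A. A \<subseteq> points \<xi> \<and> |A| \<le>o \<kappa> \<and> (\<forall>B. in_filter B (inf D H) \<longrightarrow> A \<inter> B \<noteq> {})))"
    using D by (intro exI[of _ D] conjI allI impI; (elim conjE)?) (assumption | rule meets)+
qed

text \<open>
  Tightness enters the construction of subcovers only through this instance, where the countably
  based filter is the principal filter of a set \<open>K\<close>; the points found can then be taken in \<open>K\<close>.
\<close>

lemma tightness_at_le_principal: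
  assumes tight: "tightness_at_le \<xi> y \<kappa>"
    and F: "filter_on (points \<xi>) F" "y \<in> lims \<xi> F"
    and K: "K \<subseteq> points \<xi>" "\<And>A. in_filter A F \<Longrightarrow> A \<inter> K \<noteq> {}"
  obtains D A where "filter_on (points \<xi>) D" "y \<in> lims \<xi> D"
    "A \<subseteq> K" "|A| \<le>o \<kappa>" "\<And>B. in_filter B D \<Longrightarrow> A \<inter> B \<noteq> {}"
proof -
  obtain D where D: "filter_on (points \<xi>) D" "F \<le> D" "y \<in> lims \<xi> D"
      "\<And>H. filter_on (points \<xi>) H \<and> countably_based H \<and> mesh D H \<Longrightarrow>
        \<exists>A. A \<subseteq> points \<xi> \<and> |A| \<le>o \<kappa> \<and> (\<forall>B. in_filter B (inf D H) \<longrightarrow> A \<inter> B \<noteq> {})"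
    using tight[unfolded tightness_at_le_def, rule_format, OF conjI[OF F]] by blast
  have mesh: "mesh D (principal K)"
    using K(2) in_filter_le[OF D(2)] unfolding mesh_def by fastforce
  have "K \<noteq> {}"
    using K(2) F(1) unfolding filter_on_def by blast
  then have "filter_on (points \<xi>) (principal K)"
    using K(1) by (simp add: filter_on_def bot_iff_in_filter_empty)
  moreover have "countably_based (principal K)"
    unfolding countably_based_def filter_base_def by (intro exI[of _ "{K}"]) auto
  ultimately obtain A where A: "|A| \<le>o \<kappa>" "\<And>B. in_filter B (inf D (principal K)) \<Longrightarrow> A \<inter> B \<noteq> {}"
    using D(4) mesh by blast
  have "A \<inter> K \<inter> B \<noteq> {}" if "in_filter B D" for B
  proof -
    have "in_filter (K \<inter> B) (inf D (principal K))"
      using that unfolding in_filter_def eventually_inf_principal by (auto elim: eventually_mono)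
    then show ?thesis
      using A(2) by blast
  qed
  moreover have "|A \<inter> K| \<le>o \<kappa>"
    using A(1) by (rule subset_ordLeq[rotated]) auto
  ultimately show thesis
    using that[of D "A \<inter> K"] D(1,3) by blast
qed

text \<open>
  The passage from tightness to covers, for \<open>cov p\<close> the part of \<open>X\<close> controlled by the point \<open>p\<close>.
  By \<open>near\<close>, points that control only what finitely many members of \<open>\<U>\<close> cover come arbitrarily
  close to \<open>y\<close>; tightness selects \<open>\<kappa>\<close> many of them that still come close to \<open>y\<close>, and by
  \<open>cover\<close> these together control all of \<open>X\<close>.
\<close>

lemma lindelof_le_if_tightness_at_le:
  fixes X :: "'a topology" and \<xi> :: "'y convergence" and cov :: "'y \<Rightarrow> 'a set"
  assumes \<kappa>: "Cinfinite \<kappa>" and tight: "tightness_at_le \<xi> y \<kappa>"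
    and near: "\<And>\<U>. (\<And>U. U \<in> \<U> \<Longrightarrow> openin X U) \<Longrightarrow> \<Union>\<U> = topspace X \<Longrightarrow>
      \<exists>F. filter_on (points \<xi>) F \<and> y \<in> lims \<xi> F \<and>
        (\<forall>A. in_filter A F \<longrightarrow> (\<exists>p\<in>A \<inter> points \<xi>. \<exists>\<E>\<subseteq>\<U>. finite \<E> \<and> cov p \<subseteq> \<Union>\<E>))"
    and cover: "\<And>D x. filter_on (points \<xi>) D \<Longrightarrow> y \<in> lims \<xi> D \<Longrightarrow> x \<in> topspace X \<Longrightarrow>
      in_filter {p. x \<in> cov p} D"
  shows "lindelof_le X \<kappa>"
  unfolding lindelof_le_def
proof (intro allI impI)
  fix \<U> assume \<U>: "(\<forall>U\<in>\<U>. openin X U) \<and> \<Union>\<U> = topspace X"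
  define K where "K = {p \<in> points \<xi>. \<exists>\<E>\<subseteq>\<U>. finite \<E> \<and> cov p \<subseteq> \<Union>\<E>}"
  obtain F where F: "filter_on (points \<xi>) F" "y \<in> lims \<xi> F"
      "\<And>A. in_filter A F \<Longrightarrow> \<exists>p\<in>A \<inter> points \<xi>. \<exists>\<E>\<subseteq>\<U>. finite \<E> \<and> cov p \<subseteq> \<Union>\<E>"
    using near[of \<U>] \<U> by auto
  have "A \<inter> K \<noteq> {}" if "in_filter A F" for A
    using F(3)[OF that] unfolding K_def by blast
  moreover have "K \<subseteq> points \<xi>"
    by (auto simp: K_def)
  ultimately obtain D A where D: "filter_on (points \<xi>) D" "y \<in> lims \<xi> D"
      and A: "A \<subseteq> K" "|A| \<le>o \<kappa>" "\<And>B. in_filter B D \<Longrightarrow> A \<inter> B \<noteq> {}"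
    using tightness_at_le_principal[OF tight F(1,2)] by metis
  have "\<exists>\<E>. \<E> \<subseteq> \<U> \<and> finite \<E> \<and> cov p \<subseteq> \<Union>\<E>" if "p \<in> A" for p
    using A(1) that by (auto simp: K_def)
  then obtain \<E> where \<E>: "\<And>p. p \<in> A \<Longrightarrow> \<E> p \<subseteq> \<U> \<and> finite (\<E> p) \<and> cov p \<subseteq> \<Union>(\<E> p)"
    by metis
  have "|\<Union>p\<in>A. \<E> p| \<le>o \<kappa>"
    using \<kappa> A(2) \<E> by (intro UN_Cinfinite_bound) (auto intro: finite_ordLeq_Cinfinite)
  moreover have sub: "(\<Union>p\<in>A. \<E> p) \<subseteq> \<U>"
    using \<E> by blast
  moreover have "\<Union>(\<Union>p\<in>A. \<E> p) = topspace X"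
  proof
    show "\<Union>(\<Union>p\<in>A. \<E> p) \<subseteq> topspace X"
      using sub \<U> by blast
    show "topspace X \<subseteq> \<Union>(\<Union>p\<in>A. \<E> p)"
    proof
      fix x assume "x \<in> topspace X"
      then have "A \<inter> {p. x \<in> cov p} \<noteq> {}"
        by (rule A(3)[OF cover[OF D]])
      then obtain p where p: "p \<in> A" "x \<in> cov p"
        by blast
      then have "x \<in> \<Union>(\<E> p)"
        using \<E>[OF p(1)] by blast
      then show "x \<in> \<Union>(\<Union>p\<in>A. \<E> p)"
        using p(1) by blast
    qed
  qed
  ultimately show "\<exists>\<V>\<subseteq>\<U>. \<Union>\<V> = topspace X \<and> |\<V>| \<le>o \<kappa>"
    by (intro exI[of _ "\<Union>p\<in>A. \<E> p"] conjI)
qed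

section \<open>Subsets of small Lindelof degree\<close>

text \<open>
  Neighbourhood assignments replace covers: this avoids the subspace topology, and in the
  applications the cover comes indexed by its points anyway.
\<close>

definition lindelof_subset :: "'a topology \<Rightarrow> 'a set \<Rightarrow> 'c rel \<Rightarrow> bool"
  where "lindelof_subset X Z \<kappa> \<longleftrightarrow> (\<forall>V. (\<forall>z\<in>Z. openin X (V z) \<and> z \<in> V z) \<longrightarrow>
    (\<exists>S\<subseteq>Z. |S| \<le>o \<kappa> \<and> Z \<subseteq> (\<Union>z\<in>S. V z)))"

lemma lindelof_subsetE:
  assumes "lindelof_subset X Z \<kappa>" "\<And>z. z \<in> Z \<Longrightarrow> openin X (V z)" "\<And>z. z \<in> Z \<Longrightarrow> z \<in> V z"
  obtains S where "S \<subseteq> Z" "|S| \<le>o \<kappa>" "Z \<subseteq> (\<Union>z\<in>S. V z)"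
proof -
  have "(\<forall>z\<in>Z. openin X (V z) \<and> z \<in> V z) \<longrightarrow>
      (\<exists>S\<subseteq>Z. |S| \<le>o \<kappa> \<and> Z \<subseteq> (\<Union>z\<in>S. V z))"
    using assms(1) unfolding lindelof_subset_def by (rule spec)
  moreover have "\<forall>z\<in>Z. openin X (V z) \<and> z \<in> V z"
    using assms(2,3) by simp
  ultimately have "\<exists>S\<subseteq>Z. |S| \<le>o \<kappa> \<and> Z \<subseteq> (\<Union>z\<in>S. V z)"
    by (rule mp)
  then show thesis
    by (elim exE conjE) (rule that)
qed

lemma lindelof_subset_topspace:
  assumes "lindelof_le X \<kappa>"
  shows "lindelof_subset X (topspace X) \<kappa>"
  unfolding lindelof_subset_def
proof (intro allI impI)
  fix V assume V: "\<forall>z\<in>topspace X. openin X (V z) \<and> z \<in> V z"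
  have "(\<forall>U\<in>V ` topspace X. openin X U) \<and> \<Union>(V ` topspace X) = topspace X"
    using V openin_subset by fastforce
  then have "\<exists>\<V>\<subseteq>V ` topspace X. \<Union>\<V> = topspace X \<and> |\<V>| \<le>o \<kappa>"
    by (rule assms[unfolded lindelof_le_def, rule_format])
  then obtain \<V> where \<V>: "\<V> \<subseteq> V ` topspace X" "\<Union>\<V> = topspace X" "|\<V>| \<le>o \<kappa>"
    by blast
  let ?S = "inv_into (topspace X) V ` \<V>"
  have "V ` ?S = \<V>"
    using \<V>(1) by (rule image_inv_into_cancel[OF refl])
  moreover have "?S \<subseteq> topspace X"
    using \<V>(1) inv_into_into[of _ V "topspace X"] by blast
  moreover have "|?S| \<le>o \<kappa>"
    using \<V>(3) by (rule image_ordLeq)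
  ultimately show "\<exists>S\<subseteq>topspace X. |S| \<le>o \<kappa> \<and> topspace X \<subseteq> (\<Union>z\<in>S. V z)"
    using \<V>(2) by (intro exI[of _ ?S]) simp
qed

lemma lindelof_subset_closed:
  assumes "lindelof_subset X (topspace X) \<kappa>" "closedin X C"
  shows "lindelof_subset X C \<kappa>"
  unfolding lindelof_subset_def
proof (intro allI impI)
  fix V assume V: "\<forall>z\<in>C. openin X (V z) \<and> z \<in> V z"
  let ?V = "\<lambda>z. if z \<in> C then V z else topspace X - C"
  obtain S where S: "S \<subseteq> topspace X" "|S| \<le>o \<kappa>" "topspace X \<subseteq> (\<Union>z\<in>S. ?V z)"
  proof (rule lindelof_subsetE[OF assms(1), of ?V])
    show "openin X (?V z)" "z \<in> ?V z" if "z \<in> topspace X" for z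
      using V assms(2) that by auto
  qed
  have "|S \<inter> C| \<le>o \<kappa>"
    using S(2) by (rule subset_ordLeq[rotated]) blast
  moreover have "C \<subseteq> (\<Union>z\<in>S \<inter> C. V z)"
  proof
    fix c assume c: "c \<in> C"
    then obtain z where "z \<in> S" "c \<in> ?V z"
      using S(3) closedin_subset[OF assms(2)] by blast
    then show "c \<in> (\<Union>z\<in>S \<inter> C. V z)"
      using c by (cases "z \<in> C") auto
  qed
  ultimately show "\<exists>S\<subseteq>C. |S| \<le>o \<kappa> \<and> C \<subseteq> (\<Union>z\<in>S. V z)"
    by (intro exI[of _ "S \<inter> C"]) simp
qed

lemma lindelof_subset_UN:
  assumes \<kappa>: "Cinfinite \<kappa>" "|I| \<le>o \<kappa>" and Z: "\<And>i. i \<in> I \<Longrightarrow> lindelof_subset X (Z i) \<kappa>"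
  shows "lindelof_subset X (\<Union>i\<in>I. Z i) \<kappa>"
  unfolding lindelof_subset_def
proof (intro allI impI)
  fix V assume V: "\<forall>z\<in>(\<Union>i\<in>I. Z i). openin X (V z) \<and> z \<in> V z"
  have "\<exists>S. S \<subseteq> Z i \<and> |S| \<le>o \<kappa> \<and> Z i \<subseteq> (\<Union>z\<in>S. V z)" if i: "i \<in> I" for i
  proof (rule lindelof_subsetE[OF Z[OF i], of V])
    show "openin X (V z)" "z \<in> V z" if "z \<in> Z i" for z
      using V i that by auto
  qed blast
  then obtain S where S: "\<And>i. i \<in> I \<Longrightarrow> S i \<subseteq> Z i \<and> |S i| \<le>o \<kappa> \<and> Z i \<subseteq> (\<Union>z\<in>S i. V z)"
    by metis
  have "|\<Union>i\<in>I. S i| \<le>o \<kappa>"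
    using S by (intro UN_Cinfinite_bound[OF \<kappa>]) simp
  moreover have "(\<Union>i\<in>I. S i) \<subseteq> (\<Union>i\<in>I. Z i)"
    using S by (intro UN_mono) auto
  moreover have "(\<Union>i\<in>I. Z i) \<subseteq> (\<Union>z\<in>(\<Union>i\<in>I. S i). V z)"
  proof (rule UN_least)
    fix i assume i: "i \<in> I"
    then have "(\<Union>z\<in>S i. V z) \<subseteq> (\<Union>z\<in>(\<Union>i\<in>I. S i). V z)"
      by (intro UN_mono) auto
    then show "Z i \<subseteq> (\<Union>z\<in>(\<Union>i\<in>I. S i). V z)"
      using S[OF i] by (meson subset_trans)
  qed
  ultimately show "\<exists>S\<subseteq>(\<Union>i\<in>I. Z i). |S| \<le>o \<kappa> \<and> (\<Union>i\<in>I. Z i) \<subseteq> (\<Union>z\<in>S. V z)"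
    by (intro exI[of _ "\<Union>i\<in>I. S i"] conjI)
qed

lemma separating_function:
  assumes "completely_regular_space X" "openin X U" "x \<in> U"
  obtains f where "continuous_map X euclideanreal f" "f x = 0"
    "\<And>z. z \<in> topspace X \<Longrightarrow> 0 \<le> f z" "\<And>z. z \<in> topspace X - U \<Longrightarrow> f z = 1"
proof -
  have "closedin X (topspace X - U)" "x \<in> topspace X - (topspace X - U)"
    using assms(2,3) openin_subset by blast+
  then obtain f :: "'a \<Rightarrow> real" where f: "continuous_map X (top_of_set {0..1}) f" "f x = 0"
      "f ` (topspace X - U) \<subseteq> {1}"
    using assms(1) unfolding completely_regular_space_def by metis
  then show thesis
    by (intro that[of f]) (auto simp: continuous_map_in_subtopology)
qed

text \<open>
  A neighbourhood \<open>{f < 1}\<close> given by complete regularity is the union of the closed sets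
  \<open>{f \<le> 1 - 1/n}\<close>, and these inherit the Lindelof degree of \<open>X\<close>.
\<close>

lemma lindelof_open_base:
  assumes \<kappa>: "Cinfinite \<kappa>" and X: "completely_regular_space X" "lindelof_subset X (topspace X) \<kappa>"
    and U: "openin X U" "x \<in> U"
  obtains Z where "openin X Z" "x \<in> Z" "Z \<subseteq> U" "lindelof_subset X Z \<kappa>"
proof -
  obtain f where f: "continuous_map X euclideanreal f" "f x = 0"
      "\<And>z. z \<in> topspace X - U \<Longrightarrow> f z = 1"
    using separating_function[OF X(1) U] by metis
  let ?Z = "{z \<in> topspace X. f z \<in> {..<1}}"
  have "openin X ?Z"
    using f(1) by (rule openin_continuous_map_preimage) simp
  moreover have "x \<in> ?Z"
    using U openin_subset[OF U(1)] f(2) by auto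
  moreover have "?Z \<subseteq> U"
    using f(3) by force
  moreover have "lindelof_subset X ?Z \<kappa>"
  proof -
    let ?C = "\<lambda>n. {z \<in> topspace X. f z \<in> {..1 - 1 / real (Suc n)}}"
    have "closedin X (?C n)" for n
      using f(1) by (rule closedin_continuous_map_preimage) simp
    then have "lindelof_subset X (\<Union>n\<in>UNIV. ?C n) \<kappa>"
      by (intro lindelof_subset_UN \<kappa> countable_ordLeq_Cinfinite lindelof_subset_closed[OF X(2)])
        simp_all
    moreover have "?Z = (\<Union>n\<in>UNIV. ?C n)"
    proof -
      have "\<exists>n. f z \<le> 1 - 1 / real (Suc n)" if z: "f z < 1" for z
      proof -
        obtain n where "inverse (real (Suc n)) < 1 - f z"
          using reals_Archimedean[of "1 - f z"] z by (auto simp del: of_nat_Suc)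
        then have "f z \<le> 1 - 1 / real (Suc n)"
          by (simp add: inverse_eq_divide)
        then show ?thesis ..
      qed
      moreover have "1 - 1 / real (Suc n) < 1" for n
        by simp
      ultimately show ?thesis
        by (auto simp del: of_nat_Suc intro: order.strict_trans1)
    qed
    ultimately show ?thesis by simp
  qed
  ultimately show thesis
    by (rule that)
qed

section \<open>The natural convergence on open sets\<close>

lemma points_open_sets_convergence [simp]:
  "points (open_sets_convergence X) = {U. openin X U}"
  by (simp add: open_sets_convergence_def)

lemma in_lims_open_sets_convergence:
  "Y \<in> lims (open_sets_convergence X) F \<longleftrightarrow>
    openin X Y \<and> (\<forall>x\<in>Y. \<exists>\<G>. in_filter \<G> F \<and> x \<in> X interior_of (\<Inter>\<G>))"
  by (auto simp: open_sets_convergence_def)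

text \<open>
  The coarsest filter on the open sets along which each \<open>U \<in> \<U>\<close> is eventually contained.
\<close>

definition cover_filter :: "'a topology \<Rightarrow> 'a set set \<Rightarrow> 'a set filter"
  where "cover_filter X \<U> =
    generated_filter (insert {Y. openin X Y} ((\<lambda>U. {Y. openin X Y \<and> U \<subseteq> Y}) ` \<U>))"

lemma filter_on_cover_filter:
  assumes "\<And>U. U \<in> \<U> \<Longrightarrow> openin X U"
  shows "filter_on {U. openin X U} (cover_filter X \<U>)"
  unfolding cover_filter_def
  by (rule filter_on_generated_filter[of "topspace X"]) (use assms openin_subset in auto)

lemma in_cover_filter:
  assumes "in_filter \<G> (cover_filter X \<U>)"
  obtains \<E> where "\<E> \<subseteq> \<U>" "finite \<E>" "\<And>Y. openin X Y \<Longrightarrow> \<Union>\<E> \<subseteq> Y \<Longrightarrow> Y \<in> \<G>"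
proof -
  let ?f = "\<lambda>U. {Y. openin X Y \<and> U \<subseteq> Y}"
  obtain \<H> where \<H>: "\<H> \<subseteq> insert {Y. openin X Y} (?f ` \<U>)" "finite \<H>" "\<Inter>\<H> \<subseteq> \<G>"
    using assms unfolding cover_filter_def in_generated_filter by blast
  then have "finite (\<H> \<inter> ?f ` \<U>)" by simp
  then obtain \<E> where \<E>: "\<E> \<subseteq> \<U>" "finite \<E>" "\<H> \<inter> ?f ` \<U> = ?f ` \<E>"
    using finite_subset_image[of "\<H> \<inter> ?f ` \<U>" ?f \<U>] by auto
  have "Y \<in> \<G>" if Y: "openin X Y" "\<Union>\<E> \<subseteq> Y" for Y
  proof -
    have "Y \<in> H" if "H \<in> \<H>" for H
    proof (cases "H = {Y. openin X Y}")
      case False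
      then have "H \<in> ?f ` \<E>"
        using that \<H>(1) \<E>(3) by blast
      then show ?thesis using Y by blast
    qed (use Y in simp)
    then show ?thesis using \<H>(3) by blast
  qed
  then show thesis using that \<E>(1,2) by blast
qed

lemma cover_filter_converges:
  assumes "\<And>U. U \<in> \<U> \<Longrightarrow> openin X U"
  shows "\<Union>\<U> \<in> lims (open_sets_convergence X) (cover_filter X \<U>)"
  unfolding in_lims_open_sets_convergence
proof (intro conjI ballI)
  fix x assume "x \<in> \<Union>\<U>"
  then obtain U where U: "U \<in> \<U>" "x \<in> U" by blast
  let ?G = "{Y. openin X Y \<and> U \<subseteq> Y}"
  have "in_filter ?G (cover_filter X \<U>)"
    unfolding cover_filter_def using U by (intro in_generated_filterI[of ?G]) auto
  moreover have "x \<in> X interior_of (\<Inter>?G)"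
    using U assms by (auto intro!: interior_of_maximal[THEN subsetD, of U])
  ultimately show "\<exists>\<G>. in_filter \<G> (cover_filter X \<U>) \<and> x \<in> X interior_of (\<Inter>\<G>)"
    by blast
qed (use assms in blast)

lemma character_open_sets_le_if_lindelof_le:
  assumes \<kappa>: "Cinfinite \<kappa>" and X: "lindelof_subset X (topspace X) \<kappa>"
  shows "character_at_le (open_sets_convergence X) (topspace X) \<kappa>"
  unfolding character_at_le_def
proof (intro allI impI)
  let ?\<xi> = "open_sets_convergence X"
  fix F assume F: "filter_on (points ?\<xi>) F \<and> topspace X \<in> lims ?\<xi> F"
  then have "\<forall>x\<in>topspace X. \<exists>\<G>. in_filter \<G> F \<and> x \<in> X interior_of (\<Inter>\<G>)"
    by (simp add: in_lims_open_sets_convergence)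
  then obtain \<G> where \<G>: "\<And>x. x \<in> topspace X \<Longrightarrow> in_filter (\<G> x) F"
      "\<And>x. x \<in> topspace X \<Longrightarrow> x \<in> X interior_of (\<Inter>(\<G> x))"
    by metis
  obtain S where S: "S \<subseteq> topspace X" "|S| \<le>o \<kappa>"
      "topspace X \<subseteq> (\<Union>x\<in>S. X interior_of (\<Inter>(\<G> x)))"
    using lindelof_subsetE[OF X, of "\<lambda>x. X interior_of (\<Inter>(\<G> x))"] \<G>(2) by auto
  have "\<And>G. G \<in> \<G> ` S \<Longrightarrow> in_filter G F"
    using \<G>(1) S(1) by auto
  then obtain D where D: "filter_on (points ?\<xi>) D" "F \<le> D" "\<And>G. G \<in> \<G> ` S \<Longrightarrow> in_filter G D"
      "\<exists>\<B>. filter_base \<B> D \<and> |\<B>| \<le>o \<kappa>"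
    using small_coarser_filter[OF \<kappa> conjunct1[OF F] _ image_ordLeq[OF S(2)], of \<G>] by metis
  have "topspace X \<in> lims ?\<xi> D"
    unfolding in_lims_open_sets_convergence
  proof (intro conjI ballI openin_topspace)
    fix x assume "x \<in> topspace X"
    then obtain z where "z \<in> S" "x \<in> X interior_of (\<Inter>(\<G> z))"
      using S(3) by blast
    then show "\<exists>\<G>. in_filter \<G> D \<and> x \<in> X interior_of (\<Inter>\<G>)"
      using D(3)[OF imageI] by (intro exI[of _ "\<G> z"] conjI)
  qed
  then show "\<exists>D. filter_on (points ?\<xi>) D \<and> F \<le> D \<and> topspace X \<in> lims ?\<xi> D \<and>
      (\<exists>\<B>. filter_base \<B> D \<and> |\<B>| \<le>o \<kappa>)"
    using D(1,2,4) by (intro exI[of _ D] conjI)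
qed

section \<open>The topological modification\<close>

text \<open>
  Open sets of \<open>T[X,$]\<close> are the compact families, that is, the Scott open sets of the lattice of
  open sets.  Openness forces compactness because the cover filter of \<open>\<U>\<close> converges to
  \<open>\<Union>\<U>\<close>, and monotonicity because the principal filter of \<open>Z\<close> converges to every open subset
  of \<open>Z\<close>.  Conversely, if \<open>F\<close> converges to \<open>Y\<close>, then the sets \<open>int (\<Inter>\<G>)\<close> with
  \<open>\<G> \<in> F\<close> cover \<open>Y\<close>, and compactness reduces them to finitely many.
\<close>

lemma modification_open_open_sets_iff:
  "modification_open (open_sets_convergence X) W \<longleftrightarrow>
    (\<forall>Y\<in>W. openin X Y) \<and> (\<forall>Y\<in>W. \<forall>Z. openin X Z \<and> Y \<subseteq> Z \<longrightarrow> Z \<in> W) \<and>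
    (\<forall>\<U>. (\<forall>U\<in>\<U>. openin X U) \<and> \<Union>\<U> \<in> W \<longrightarrow> (\<exists>\<E>\<subseteq>\<U>. finite \<E> \<and> \<Union>\<E> \<in> W))"
  (is "?open \<longleftrightarrow> ?sub \<and> ?up \<and> ?compact")
proof
  let ?\<xi> = "open_sets_convergence X"
  assume W: ?open
  then have sub: "openin X Y" if "Y \<in> W" for Y
    using that by (auto simp: modification_open_def)
  have inW: "in_filter W F"
    if "filter_on {U. openin X U} F" "Y \<in> lims ?\<xi> F" "Y \<in> W" for F Y
  proof -
    have "lims ?\<xi> F \<inter> W \<noteq> {}"
      using that by blast
    then show ?thesis
      using W that(1) unfolding modification_open_def by simp
  qed
  have up: ?up
  proof (intro ballI allI impI)
    fix Y Z assume Y: "Y \<in> W" and Z: "openin X Z \<and> Y \<subseteq> Z"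
    have "in_filter W (principal {Z})"
    proof (rule inW[OF _ _ Y])
      show "filter_on {U. openin X U} (principal {Z})"
        using Z by (simp add: filter_on_def bot_iff_in_filter_empty)
      have "in_filter {Z} (principal {Z})" "Y \<subseteq> X interior_of (\<Inter>{Z})"
        using Z by (simp_all add: interior_of_openin)
      then show "Y \<in> lims ?\<xi> (principal {Z})"
        unfolding in_lims_open_sets_convergence using sub[OF Y] by blast
    qed
    then show "Z \<in> W" by simp
  qed
  moreover have ?compact
  proof (intro allI impI)
    fix \<U> assume \<U>: "(\<forall>U\<in>\<U>. openin X U) \<and> \<Union>\<U> \<in> W"
    then have "in_filter W (cover_filter X \<U>)"
      by (intro inW[OF filter_on_cover_filter cover_filter_converges]) auto
    then obtain \<E> where \<E>: "\<E> \<subseteq> \<U>" "finite \<E>" "\<And>Y. openin X Y \<Longrightarrow> \<Union>\<E> \<subseteq> Y \<Longrightarrow> Y \<in> W"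
      using in_cover_filter by metis
    moreover have "openin X (\<Union>\<E>)"
      using \<E>(1) \<U> by blast
    ultimately show "\<exists>\<E>\<subseteq>\<U>. finite \<E> \<and> \<Union>\<E> \<in> W"
      by (intro exI[of _ \<E>]) simp
  qed
  moreover have ?sub
    using sub by (rule ballI)
  ultimately show "?sub \<and> ?up \<and> ?compact"
    by (intro conjI)
next
  let ?\<xi> = "open_sets_convergence X"
  assume W: "?sub \<and> ?up \<and> ?compact"
  note sub = conjunct1[OF W] and up = conjunct1[OF conjunct2[OF W]]
  have "in_filter W F"
    if F: "filter_on {U. openin X U} F" and Y: "Y \<in> lims ?\<xi> F" "Y \<in> W" for F Y
  proof -
    let ?int = "\<lambda>\<G>. X interior_of (\<Inter>\<G>)"
    let ?\<U> = "?int ` {\<G>. in_filter \<G> F}"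
    have "Y \<subseteq> \<Union>?\<U>"
      using Y(1) by (auto simp: in_lims_open_sets_convergence)
    moreover have "openin X (\<Union>?\<U>)"
      by (rule openin_Union) auto
    ultimately have "\<Union>?\<U> \<in> W"
      using up[rule_format, OF Y(2)] by blast
    moreover have "\<forall>U\<in>?\<U>. openin X U"
      by simp
    ultimately have "(\<forall>U\<in>?\<U>. openin X U) \<and> \<Union>?\<U> \<in> W"
      by (intro conjI)
    then have "\<exists>\<E>\<subseteq>?\<U>. finite \<E> \<and> \<Union>\<E> \<in> W"
      by (rule mp[OF spec[OF conjunct2[OF conjunct2[OF W]]]])
    then obtain \<E> where \<E>: "\<E> \<subseteq> ?\<U>" "finite \<E>" "\<Union>\<E> \<in> W"
      by (elim exE conjE)
    then obtain \<H> where \<H>: "\<H> \<subseteq> {\<G>. in_filter \<G> F}" "finite \<H>" "\<E> = ?int ` \<H>"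
      using finite_subset_image[OF \<E>(2,1)] by auto
    have "in_filter (\<Inter>\<H> \<inter> {U. openin X U}) F"
      using \<H>(1,2) F by (intro in_filter_Int in_filter_Inter) (auto simp: filter_on_def)
    moreover have "\<Inter>\<H> \<inter> {U. openin X U} \<subseteq> W"
    proof
      fix Z assume Z: "Z \<in> \<Inter>\<H> \<inter> {U. openin X U}"
      have "?int \<G> \<subseteq> Z" if "\<G> \<in> \<H>" for \<G>
        using interior_of_subset[of X "\<Inter>\<G>"] Z that by blast
      then have "\<Union>\<E> \<subseteq> Z"
        using \<H>(3) by blast
      then show "Z \<in> W"
        using Z by (intro up[rule_format, OF \<E>(3)] conjI) simp_all
    qed
    ultimately show ?thesis
      by (rule in_filter_mono)
  qed
  then show ?open
    unfolding modification_open_def points_open_sets_convergence using sub by blast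
qed

lemma points_T_mod: "is_convergence \<xi> \<Longrightarrow> points (T_mod \<xi>) = points \<xi>"
  by (simp add: T_mod_def topology_convergence_def topspace_topological_modification)

lemma in_lims_T_mod:
  assumes "is_convergence \<xi>"
  shows "y \<in> lims (T_mod \<xi>) F \<longleftrightarrow>
    y \<in> points \<xi> \<and> (\<forall>W. modification_open \<xi> W \<and> y \<in> W \<longrightarrow> in_filter W F)"
  using assms
  by (simp add: T_mod_def topology_convergence_def limitin_def in_filter_def
      openin_topological_modification topspace_topological_modification)

lemma lims_subset_lims_T_mod:
  assumes "is_convergence \<xi>" "filter_on (points \<xi>) F"
  shows "lims \<xi> F \<subseteq> lims (T_mod \<xi>) F"
proof
  fix y assume y: "y \<in> lims \<xi> F"
  then have "y \<in> points \<xi>"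
    using assms unfolding is_convergence_def by blast
  moreover have "in_filter W F" if "modification_open \<xi> W" "y \<in> W" for W
  proof -
    have "lims \<xi> F \<inter> W \<noteq> {}"
      using y that(2) by blast
    then show ?thesis
      using that(1) assms(2) unfolding modification_open_def by simp
  qed
  ultimately show "y \<in> lims (T_mod \<xi>) F"
    using in_lims_T_mod[OF assms(1)] by blast
qed

text \<open>
  In a topology, the neighbourhood filter of \<open>y\<close> is the coarsest filter that converges to \<open>y\<close>, and
  a countable base of \<open>H\<close> can be treated one member at a time.  So it suffices to bound tightness
  in the usual sense: every set with \<open>y\<close> in its closure has a subset of size \<open>\<kappa>\<close> with \<open>y\<close> in
  its closure.
\<close>

lemma tightness_at_le_T_mod:
  fixes \<xi> :: "'y convergence"
  assumes \<kappa>: "Cinfinite \<kappa>" and \<xi>: "is_convergence \<xi>"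
    and small: "\<And>\<B>. \<B> \<subseteq> points \<xi> \<Longrightarrow>
      (\<And>W. modification_open \<xi> W \<Longrightarrow> y \<in> W \<Longrightarrow> W \<inter> \<B> \<noteq> {}) \<Longrightarrow>
      \<exists>A\<subseteq>\<B>. |A| \<le>o \<kappa> \<and> (\<forall>W. modification_open \<xi> W \<and> y \<in> W \<longrightarrow> W \<inter> A \<noteq> {})"
  shows "tightness_at_le (T_mod \<xi>) y \<kappa>"
  unfolding tightness_at_le_def points_T_mod[OF \<xi>]
proof (intro allI impI)
  let ?\<T> = "topological_modification \<xi>"
  fix F assume F: "filter_on (points \<xi>) F \<and> y \<in> lims (T_mod \<xi>) F"
  then have y: "y \<in> points \<xi>"
    using in_lims_T_mod[OF \<xi>] by blast
  let ?D = "nhdsin ?\<T> y"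
  have D: "in_filter A ?D \<longleftrightarrow> (\<exists>W. modification_open \<xi> W \<and> y \<in> W \<and> W \<subseteq> A)" for A
    using y by (auto simp: in_filter_def eventually_nhdsin topspace_topological_modification[OF \<xi>]
        openin_topological_modification)
  have FD: "F \<le> ?D"
    unfolding filter_le_iff D using F in_lims_T_mod[OF \<xi>, of y F] in_filter_mono by metis
  have "in_filter (points \<xi>) ?D"
    using y unfolding D by (intro exI[of _ "points \<xi>"]) (simp add: modification_open_def filter_on_def)
  moreover have "?D \<noteq> bot"
    unfolding bot_iff_in_filter_empty D by blast
  ultimately have "filter_on (points \<xi>) ?D"
    by (simp add: filter_on_def)
  moreover have "y \<in> lims (T_mod \<xi>) ?D"
    using y D by (auto simp: in_lims_T_mod[OF \<xi>])
  moreover have "\<exists>A\<subseteq>points \<xi>. |A| \<le>o \<kappa> \<and> (\<forall>B. in_filter B (inf ?D H) \<longrightarrow> A \<inter> B \<noteq> {})"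
    if H: "filter_on (points \<xi>) H \<and> countably_based H \<and> mesh ?D H" for H
  proof -
    obtain \<C> where \<C>: "countable \<C>" "filter_base \<C> H"
      using H unfolding countably_based_def by blast
    have "\<exists>A\<subseteq>C \<inter> points \<xi>. |A| \<le>o \<kappa> \<and>
        (\<forall>W. modification_open \<xi> W \<and> y \<in> W \<longrightarrow> W \<inter> A \<noteq> {})" if C: "C \<in> \<C>" for C
    proof (rule small)
      fix W assume W: "modification_open \<xi> W" "y \<in> W"
      then have "in_filter W ?D"
        unfolding D by blast
      moreover have "in_filter C H"
        using \<C>(2) C unfolding filter_base_def by blast
      then have "in_filter (C \<inter> points \<xi>) H"
        using H by (simp add: in_filter_Int filter_on_def)
      ultimately show "W \<inter> (C \<inter> points \<xi>) \<noteq> {}"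
        using H unfolding mesh_def by blast
    qed simp
    then have "\<forall>C\<in>\<C>. \<exists>A. A \<subseteq> C \<inter> points \<xi> \<and> |A| \<le>o \<kappa> \<and>
        (\<forall>W. modification_open \<xi> W \<and> y \<in> W \<longrightarrow> W \<inter> A \<noteq> {})"
      by blast
    from bchoice[OF this] obtain A where A: "\<forall>C\<in>\<C>. A C \<subseteq> C \<inter> points \<xi> \<and> |A C| \<le>o \<kappa> \<and>
        (\<forall>W. modification_open \<xi> W \<and> y \<in> W \<longrightarrow> W \<inter> A C \<noteq> {})"
      by (rule exE)
    have "|\<Union>C\<in>\<C>. A C| \<le>o \<kappa>"
      using A by (intro UN_Cinfinite_bound[OF \<kappa> countable_ordLeq_Cinfinite[OF \<kappa> \<C>(1)]]) simp
    moreover have "(\<Union>C\<in>\<C>. A C) \<subseteq> points \<xi>"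
      using A by blast
    moreover have "(\<Union>C\<in>\<C>. A C) \<inter> B \<noteq> {}" if B: "in_filter B (inf ?D H)" for B
    proof -
      obtain P Q where PQ: "eventually P ?D" "eventually Q H" "\<And>z. P z \<and> Q z \<Longrightarrow> z \<in> B"
        using B unfolding in_filter_def eventually_inf by blast
      then have "in_filter (Collect P) ?D" "in_filter (Collect Q) H"
        by (simp_all add: in_filter_def)
      then obtain W C where WC: "modification_open \<xi> W" "y \<in> W" "W \<subseteq> Collect P"
          "C \<in> \<C>" "C \<subseteq> Collect Q"
        using \<C>(2) unfolding D filter_base_def by blast
      have AC: "A C \<subseteq> C" "W \<inter> A C \<noteq> {}"
        using bspec[OF A WC(4)] WC(1,2) by simp_all
      then obtain z where z: "z \<in> W" "z \<in> A C"
        by blast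
      have "z \<in> B"
        using z AC(1) WC(3,5) by (intro PQ(3)) blast
      then show ?thesis
        using z(2) WC(4) by blast
    qed
    ultimately show ?thesis
      by (intro exI[of _ "\<Union>C\<in>\<C>. A C"] conjI allI impI)
  qed
  ultimately show "\<exists>D. filter_on (points \<xi>) D \<and> F \<le> D \<and> y \<in> lims (T_mod \<xi>) D \<and>
      (\<forall>H. filter_on (points \<xi>) H \<and> countably_based H \<and> mesh D H \<longrightarrow>
        (\<exists>A. A \<subseteq> points \<xi> \<and> |A| \<le>o \<kappa> \<and> (\<forall>B. in_filter B (inf D H) \<longrightarrow> A \<inter> B \<noteq> {})))"
    using FD by (intro exI[of _ ?D] conjI allI impI)
qed

text \<open>
  Let \<open>C\<close> be the union of the closures of all subfamilies of \<open>\<B>\<close> of size at most \<open>\<kappa>\<close>.  The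
  complement of \<open>C\<close> need not be compact, because an open set may have a large Lindelof degree.
  This is repaired by \<open>W\<^sub>0\<close>, the upward closure of the sets outside \<open>C\<close> that have Lindelof
  degree at most \<open>\<kappa>\<close>.  It is open and misses \<open>\<B>\<close>, so \<open>X\<close>, being in the closure of \<open>\<B>\<close>, is
  not in it; since \<open>X\<close> itself has Lindelof degree at most \<open>\<kappa>\<close>, this puts \<open>X\<close> in \<open>C\<close>.
\<close>

lemma small_subset_with_topspace_in_closure:
  fixes X :: "'a topology"
  assumes \<kappa>: "Cinfinite \<kappa>" and X: "completely_regular_space X" "lindelof_subset X (topspace X) \<kappa>"
    and B: "\<B> \<subseteq> {U. openin X U}"
      "\<And>W. modification_open (open_sets_convergence X) W \<Longrightarrow> topspace X \<in> W \<Longrightarrow> W \<inter> \<B> \<noteq> {}"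
  shows "\<exists>A\<subseteq>\<B>. |A| \<le>o \<kappa> \<and>
    (\<forall>W. modification_open (open_sets_convergence X) W \<and> topspace X \<in> W \<longrightarrow> W \<inter> A \<noteq> {})"
proof -
  let ?open = "modification_open (open_sets_convergence X)"
  define C where "C = {Y. \<exists>A\<subseteq>\<B>. |A| \<le>o \<kappa> \<and> (\<forall>W. ?open W \<and> Y \<in> W \<longrightarrow> W \<inter> A \<noteq> {})}"
  define W\<^sub>0 where "W\<^sub>0 = {Y. openin X Y \<and>
    (\<exists>Z\<subseteq>Y. openin X Z \<and> lindelof_subset X Z \<kappa> \<and> Z \<notin> C)}"
  have up: "Z \<in> W" if "?open W" "Y \<in> W" "openin X Z" "Y \<subseteq> Z" for W Y Z
    using that modification_open_open_sets_iff[of X W] by blast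
  have compact: "\<exists>\<E>\<subseteq>\<U>. finite \<E> \<and> \<Union>\<E> \<in> W"
    if "?open W" "\<And>U. U \<in> \<U> \<Longrightarrow> openin X U" "\<Union>\<U> \<in> W" for W \<U>
    using that modification_open_open_sets_iff[of X W] by blast
  have open_W\<^sub>0: "?open W\<^sub>0"
    unfolding modification_open_open_sets_iff
  proof (intro conjI ballI allI impI)
    show "openin X Y" if "Y \<in> W\<^sub>0" for Y
      using that by (simp add: W\<^sub>0_def)
    show "Y' \<in> W\<^sub>0" if "Y \<in> W\<^sub>0" "openin X Y' \<and> Y \<subseteq> Y'" for Y Y'
      using that unfolding W\<^sub>0_def by blast
    fix \<U> assume \<U>: "(\<forall>U\<in>\<U>. openin X U) \<and> \<Union>\<U> \<in> W\<^sub>0"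
    then obtain Z where Z: "Z \<subseteq> \<Union>\<U>" "openin X Z" "lindelof_subset X Z \<kappa>" "Z \<notin> C"
      unfolding W\<^sub>0_def by blast
    \<comment> \<open>Otherwise \<open>Z\<close> is covered by \<open>\<kappa>\<close> many basic sets \<open>P z\<close> whose finite unions all lie in
      \<open>C\<close>; the union of the \<open>\<kappa>\<close> many subfamilies of \<open>\<B>\<close> that witness this witnesses \<open>Z \<in> C\<close>.\<close>
    show "\<exists>\<E>\<subseteq>\<U>. finite \<E> \<and> \<Union>\<E> \<in> W\<^sub>0"
    proof (rule ccontr)
      assume none: "\<not> ?thesis"
      have "\<exists>P U. U \<in> \<U> \<and> openin X P \<and> z \<in> P \<and> P \<subseteq> U \<and> lindelof_subset X P \<kappa>" if z: "z \<in> Z" for z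
      proof -
        obtain U where U: "U \<in> \<U>" "z \<in> U"
          using z Z(1) by blast
        obtain P where "openin X P" "z \<in> P" "P \<subseteq> U" "lindelof_subset X P \<kappa>"
          using lindelof_open_base[OF \<kappa> X _ U(2)] \<U> U(1) by metis
        then show ?thesis
          using U(1) by (intro exI conjI)
      qed
      then obtain P U where P: "\<And>z. z \<in> Z \<Longrightarrow> U z \<in> \<U> \<and> openin X (P z) \<and> z \<in> P z \<and>
          P z \<subseteq> U z \<and> lindelof_subset X (P z) \<kappa>"
        by metis
      obtain S where S: "S \<subseteq> Z" "|S| \<le>o \<kappa>" "Z \<subseteq> (\<Union>z\<in>S. P z)"
        using lindelof_subsetE[OF Z(3), of P] P by blast
      have PS: "openin X (P z)" if "z \<in> S" for z
        using that S(1) P by blast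
      have "(\<Union>z\<in>E. P z) \<in> C" if E: "E \<in> Fpow S" for E
      proof (rule ccontr)
        assume notin: "(\<Union>z\<in>E. P z) \<notin> C"
        have EZ: "E \<subseteq> Z" "finite E" "E \<subseteq> S"
          using E S(1) by (auto simp: Fpow_def)
        have "openin X (\<Union>z\<in>E. P z)"
          using EZ(1) P by blast
        moreover have "lindelof_subset X (\<Union>z\<in>E. P z) \<kappa>"
          using EZ P by (intro lindelof_subset_UN[OF \<kappa> finite_ordLeq_Cinfinite[OF \<kappa>]]) auto
        moreover have "(\<Union>z\<in>E. P z) \<subseteq> \<Union>(U ` E)"
          using EZ(1) P by blast
        moreover have "openin X (\<Union>(U ` E))"
          using EZ(1) P \<U> by blast
        ultimately have "\<Union>(U ` E) \<in> W\<^sub>0"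
          using notin unfolding W\<^sub>0_def by blast
        moreover have "U ` E \<subseteq> \<U>"
          using EZ(1) P by blast
        ultimately show False
          using none EZ(2) by blast
      qed
      then have "\<forall>E\<in>Fpow S. \<exists>A. A \<subseteq> \<B> \<and> |A| \<le>o \<kappa> \<and>
          (\<forall>W. ?open W \<and> (\<Union>z\<in>E. P z) \<in> W \<longrightarrow> W \<inter> A \<noteq> {})"
        unfolding C_def by simp
      from bchoice[OF this] obtain A where A: "\<forall>E\<in>Fpow S. A E \<subseteq> \<B> \<and> |A E| \<le>o \<kappa> \<and>
          (\<forall>W. ?open W \<and> (\<Union>z\<in>E. P z) \<in> W \<longrightarrow> W \<inter> A E \<noteq> {})"
        by (rule exE)
      have "|\<Union>E\<in>Fpow S. A E| \<le>o \<kappa>"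
        using A by (intro UN_Cinfinite_bound[OF \<kappa> Fpow_Cinfinite_bound[OF \<kappa> S(2)]]) simp
      moreover have "(\<Union>E\<in>Fpow S. A E) \<subseteq> \<B>"
        using A by blast
      moreover have "W \<inter> (\<Union>E\<in>Fpow S. A E) \<noteq> {}" if W: "?open W \<and> Z \<in> W" for W
      proof -
        have "openin X (\<Union>(P ` S))"
          using PS by blast
        then have "\<Union>(P ` S) \<in> W"
          using up[of W Z "\<Union>(P ` S)"] W S(3) by blast
        then obtain \<E> where \<E>: "\<E> \<subseteq> P ` S" "finite \<E>" "\<Union>\<E> \<in> W"
          using compact[of W "P ` S"] W PS by blast
        then obtain E where E: "E \<subseteq> S" "finite E" "\<E> = P ` E"
          using finite_subset_image[of \<E> P S] by auto
        then have "E \<in> Fpow S" "(\<Union>z\<in>E. P z) \<in> W"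
          using \<E>(3) by (simp_all add: Fpow_def)
        then have "W \<inter> A E \<noteq> {}"
          using A W by blast
        then show ?thesis
          using \<open>E \<in> Fpow S\<close> by blast
      qed
      ultimately have "Z \<in> C"
        unfolding C_def by (intro CollectI exI[of _ "\<Union>E\<in>Fpow S. A E"] conjI allI impI)
      then show False
        using Z(4) by blast
    qed
  qed
  have "W\<^sub>0 \<inter> \<B> = {}"
  proof (rule ccontr)
    assume "W\<^sub>0 \<inter> \<B> \<noteq> {}"
    then obtain Y Z where Y: "Y \<in> \<B>" "openin X Y" and Z: "Z \<subseteq> Y" "Z \<notin> C"
      unfolding W\<^sub>0_def by blast
    have "|{Y}| \<le>o \<kappa>"
      using \<kappa> by (rule finite_ordLeq_Cinfinite) simp
    moreover have "W \<inter> {Y} \<noteq> {}" if "?open W \<and> Z \<in> W" for W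
      using up[of W Z Y] that Y(2) Z(1) by blast
    ultimately have "Z \<in> C"
      using Y(1) unfolding C_def by (intro CollectI exI[of _ "{Y}"] conjI allI impI) simp_all
    then show False
      using Z(2) by blast
  qed
  then have "topspace X \<notin> W\<^sub>0"
    using B(2)[OF open_W\<^sub>0] by blast
  then have "topspace X \<in> C"
    using X(2) unfolding W\<^sub>0_def by blast
  then show ?thesis
    by (simp add: C_def)
qed

lemma modification_open_point:
  "modification_open (open_sets_convergence X) {Y. openin X Y \<and> x \<in> Y}"
  unfolding modification_open_open_sets_iff
proof (intro conjI ballI allI impI)
  fix \<U> assume \<U>: "(\<forall>U\<in>\<U>. openin X U) \<and> \<Union>\<U> \<in> {Y. openin X Y \<and> x \<in> Y}"
  then obtain U where "U \<in> \<U>" "x \<in> U" by blast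
  then show "\<exists>\<E>\<subseteq>\<U>. finite \<E> \<and> \<Union>\<E> \<in> {Y. openin X Y \<and> x \<in> Y}"
    using \<U> by (intro exI[of _ "{U}"]) simp
qed auto

lemma lindelof_le_if_tightness_open_sets:
  fixes X :: "'a topology" and \<xi> :: "'a set convergence"
  assumes \<kappa>: "Cinfinite \<kappa>" and tight: "tightness_at_le \<xi> (topspace X) \<kappa>"
    and points: "points \<xi> = {U. openin X U}"
    and lims: "\<And>F. filter_on {U. openin X U} F \<Longrightarrow> lims (open_sets_convergence X) F \<subseteq> lims \<xi> F"
      "\<And>F. filter_on {U. openin X U} F \<Longrightarrow> lims \<xi> F \<subseteq> lims (T_mod (open_sets_convergence X)) F"
  shows "lindelof_le X \<kappa>"
proof (rule lindelof_le_if_tightness_at_le[OF \<kappa> tight, of _ "\<lambda>Y. Y"])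
  fix \<U> assume \<U>: "\<And>U. U \<in> \<U> \<Longrightarrow> openin X U" "\<Union>\<U> = topspace X"
  let ?F = "cover_filter X \<U>"
  have F: "filter_on {U. openin X U} ?F"
    using \<U>(1) by (rule filter_on_cover_filter)
  have "topspace X \<in> lims (open_sets_convergence X) ?F"
    using cover_filter_converges[of \<U> X] \<U> by simp
  then have "topspace X \<in> lims \<xi> ?F"
    using lims(1)[OF F] by blast
  moreover have "\<exists>Y\<in>A \<inter> points \<xi>. \<exists>\<E>\<subseteq>\<U>. finite \<E> \<and> Y \<subseteq> \<Union>\<E>" if A: "in_filter A ?F" for A
  proof -
    obtain \<E> where \<E>: "\<E> \<subseteq> \<U>" "finite \<E>" "\<And>Y. openin X Y \<Longrightarrow> \<Union>\<E> \<subseteq> Y \<Longrightarrow> Y \<in> A"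
      using in_cover_filter[OF A] by metis
    have "openin X (\<Union>\<E>)"
      using \<E>(1) \<U>(1) by blast
    then have "\<Union>\<E> \<in> A \<inter> points \<xi>"
      using \<E>(3)[of "\<Union>\<E>"] by (simp add: points)
    then show ?thesis
      using \<E>(1,2) by (intro bexI[of _ "\<Union>\<E>"] exI[of _ \<E>] conjI order_refl)
  qed
  ultimately show "\<exists>F. filter_on (points \<xi>) F \<and> topspace X \<in> lims \<xi> F \<and>
      (\<forall>A. in_filter A F \<longrightarrow> (\<exists>p\<in>A \<inter> points \<xi>. \<exists>\<E>\<subseteq>\<U>. finite \<E> \<and> p \<subseteq> \<Union>\<E>))"
    using F unfolding points by (intro exI[of _ ?F] conjI allI impI)
next
  fix D x assume D: "filter_on (points \<xi>) D" "topspace X \<in> lims \<xi> D" and x: "x \<in> topspace X"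
  then have "topspace X \<in> lims (T_mod (open_sets_convergence X)) D"
    using lims(2)[of D] unfolding points by blast
  then have "in_filter {Y. openin X Y \<and> x \<in> Y} D"
    using modification_open_point[of X x] x
    unfolding in_lims_T_mod[OF is_convergence_open_sets_convergence] by simp
  then show "in_filter {Y. x \<in> Y} D"
    by (rule in_filter_mono) auto
qed

section \<open>Continuous convergence of real functions\<close>

lemma in_points_real_maps_convergence:
  "f \<in> points (real_maps_convergence X) \<longleftrightarrow>
    f \<in> extensional (topspace X) \<and> continuous_map X euclideanreal f"
  by (simp add: real_maps_convergence_def)

lemma in_lims_real_maps_convergence:
  "f \<in> lims (real_maps_convergence X) F \<longleftrightarrow> f \<in> points (real_maps_convergence X) \<and>
    (\<forall>x\<in>topspace X. \<forall>W. open W \<and> f x \<in> W \<longrightarrow>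
      (\<exists>V A. openin X V \<and> x \<in> V \<and> in_filter A F \<and> (\<forall>g\<in>A. g ` V \<subseteq> W)))"
  by (simp add: real_maps_convergence_def)

lemma restrict_in_points_real_maps_convergence:
  "continuous_map X euclideanreal f \<Longrightarrow>
    restrict f (topspace X) \<in> points (real_maps_convergence X)"
  by (auto simp: in_points_real_maps_convergence intro: continuous_map_eq)

text \<open>
  A subcover is chosen for each precision \<open>1/n\<close>.  A point \<open>x\<close> is then served by the neighbourhood
  of another point \<open>z\<close>, at the cost of the extra error \<open>\<bar>f x - f z\<bar>\<close>; this is why the
  neighbourhoods are also made small for \<open>f\<close>.
\<close>

lemma character_real_maps_le_if_lindelof_le:
  fixes X :: "'a topology"
  assumes \<kappa>: "Cinfinite \<kappa>" and X: "lindelof_subset X (topspace X) \<kappa>"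
  shows "character_at_le (real_maps_convergence X) f \<kappa>"
  unfolding character_at_le_def
proof (intro allI impI)
  let ?\<xi> = "real_maps_convergence X"
  fix F assume F: "filter_on (points ?\<xi>) F \<and> f \<in> lims ?\<xi> F"
  then have f: "f \<in> points ?\<xi>" "continuous_map X euclideanreal f"
    by (simp_all add: in_lims_real_maps_convergence in_points_real_maps_convergence)
  let ?ball = "\<lambda>n x. ball (f x) (inverse (real (Suc n)))"
  define P where "P n x V A \<longleftrightarrow> openin X V \<and> x \<in> V \<and> in_filter A F \<and>
    (\<forall>g\<in>insert f A. g ` V \<subseteq> ?ball n x)" for n x V A
  have "\<exists>V A. P n x V A"
    if x: "x \<in> topspace X" for n x
  proof -
    have "open (?ball n x) \<and> f x \<in> ?ball n x"
      by simp
    then obtain V A where VA: "openin X V" "x \<in> V" "in_filter A F" "\<And>g. g \<in> A \<Longrightarrow> g ` V \<subseteq> ?ball n x"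
      using conjunct2[OF F] x unfolding in_lims_real_maps_convergence by meson
    \<comment> \<open>\<open>f\<close> itself need not belong to \<open>A\<close>, so its oscillation near \<open>x\<close> is bounded separately.\<close>
    let ?V = "V \<inter> {z \<in> topspace X. f z \<in> ?ball n x}"
    have "openin X ?V"
      using VA(1) f(2) by (intro openin_Int openin_continuous_map_preimage[of X euclideanreal]) auto
    moreover have "x \<in> ?V"
      using VA(2) x by simp
    moreover have "g ` ?V \<subseteq> ?ball n x" if "g \<in> insert f A" for g
      using that VA(4)[of g] by blast
    ultimately show ?thesis
      using VA(3) unfolding P_def by blast
  qed
  then have "\<forall>n x. \<exists>V A. x \<in> topspace X \<longrightarrow> P n x V A"
    by blast
  then obtain V A where PVA: "\<forall>n x. x \<in> topspace X \<longrightarrow> P n x (V n x) (A n x)"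
    by (simp only: choice_iff) blast
  have VA: "openin X (V n x) \<and> x \<in> V n x \<and> in_filter (A n x) F \<and>
      (\<forall>g\<in>insert f (A n x). g ` V n x \<subseteq> ?ball n x)" if "x \<in> topspace X" for n x
    using PVA[rule_format, OF that] unfolding P_def .
  have "\<exists>S. S \<subseteq> topspace X \<and> |S| \<le>o \<kappa> \<and> topspace X \<subseteq> (\<Union>x\<in>S. V n x)" for n
  proof (rule lindelof_subsetE[OF X, of "V n"])
    show "openin X (V n x)" "x \<in> V n x" if "x \<in> topspace X" for x
      using VA[OF that] by simp_all
  qed blast
  then obtain S where S: "\<And>n. S n \<subseteq> topspace X \<and> |S n| \<le>o \<kappa> \<and> topspace X \<subseteq> (\<Union>x\<in>S n. V n x)"
    by metis
  let ?\<G> = "\<Union>n. A n ` S n"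
  have \<G>: "|?\<G>| \<le>o \<kappa>"
    using S by (intro UN_Cinfinite_bound[OF \<kappa> countable_ordLeq_Cinfinite[OF \<kappa>]] image_ordLeq) auto
  have \<G>F: "in_filter G F" if G: "G \<in> ?\<G>" for G
  proof -
    obtain n x where "x \<in> S n" "G = A n x"
      using G by blast
    moreover have "x \<in> topspace X"
      using conjunct1[OF S[of n]] \<open>x \<in> S n\<close> by blast
    ultimately show ?thesis
      using VA[of x n] by simp
  qed
  obtain D where D: "filter_on (points ?\<xi>) D" "F \<le> D" "\<And>G. G \<in> ?\<G> \<Longrightarrow> in_filter G D"
      "\<exists>\<B>. filter_base \<B> D \<and> |\<B>| \<le>o \<kappa>"
    by (rule small_coarser_filter[OF \<kappa> conjunct1[OF F] \<G>F \<G>]) (assumption | rule that)+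
  have "f \<in> lims ?\<xi> D"
    unfolding in_lims_real_maps_convergence
  proof (intro conjI ballI allI impI f(1))
    fix x W assume x: "x \<in> topspace X" and W: "open W \<and> f x \<in> W"
    then obtain e where e: "e > 0" "ball (f x) e \<subseteq> W"
      using open_contains_ball by blast
    obtain n where n: "inverse (real (Suc n)) < e / 2"
      using reals_Archimedean[of "e / 2"] e(1) by auto
    obtain z where z: "z \<in> S n" "x \<in> V n z"
      using conjunct2[OF conjunct2[OF S[of n]]] x by blast
    then have zX: "z \<in> topspace X"
      using conjunct1[OF S[of n]] by blast
    have VAz: "openin X (V n z)" "\<And>g. g \<in> insert f (A n z) \<Longrightarrow> g ` V n z \<subseteq> ?ball n z"
      using VA[OF zX, of n] by blast+
    have fx: "f x \<in> ?ball n z"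
      using VAz(2)[of f] z(2) by blast
    have "g ` V n z \<subseteq> W" if g: "g \<in> A n z" for g
    proof
      fix r assume "r \<in> g ` V n z"
      then have "r \<in> ?ball n z"
        using VAz(2)[of g] g by blast
      then have "r \<in> ball (f x) e"
        using fx n by (auto simp: dist_real_def)
      then show "r \<in> W"
        using e(2) by blast
    qed
    moreover have "in_filter (A n z) D"
      using z(1) by (intro D(3)) blast
    ultimately show "\<exists>V A. openin X V \<and> x \<in> V \<and> in_filter A D \<and> (\<forall>g\<in>A. g ` V \<subseteq> W)"
      using VAz(1) z(2) by blast
  qed
  then show "\<exists>D. filter_on (points ?\<xi>) D \<and> F \<le> D \<and> f \<in> lims ?\<xi> D \<and>
      (\<exists>\<B>. filter_base \<B> D \<and> |\<B>| \<le>o \<kappa>)"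
    using D(1,2,4) by (intro exI[of _ D] conjI)
qed

text \<open>
  The part that the family of open sets containing a given \<open>U \<in> \<U>\<close> plays in \<open>[X,$]\<close> is taken by
  the functions between \<open>0\<close> and some \<open>f \<in> \<Phi>\<close>.  They converge to \<open>0\<close> near the zeros of \<open>f\<close>, and
  every finite intersection of such families contains the minimum of the corresponding \<open>f\<close>, which
  equals \<open>1\<close> outside a finite union of members of \<open>\<U>\<close>.
\<close>

lemma lindelof_le_if_tightness_real_maps:
  fixes X :: "'a topology"
  assumes \<kappa>: "Cinfinite \<kappa>" and X: "completely_regular_space X"
    and tight: "tightness_at_le (real_maps_convergence X) (restrict (\<lambda>_. 0) (topspace X)) \<kappa>"
  shows "lindelof_le X \<kappa>"
proof (rule lindelof_le_if_tightness_at_le[OF \<kappa> tight, of _ "\<lambda>g. {x \<in> topspace X. g x < 1}"])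
  let ?\<xi> = "real_maps_convergence X" and ?zero = "restrict (\<lambda>_. 0 :: real) (topspace X)"
  have zero: "?zero \<in> points ?\<xi>"
    by (intro restrict_in_points_real_maps_convergence) simp
  fix \<U> assume \<U>: "\<And>U. U \<in> \<U> \<Longrightarrow> openin X U" "\<Union>\<U> = topspace X"
  define \<Phi> where "\<Phi> = {f. continuous_map X euclideanreal f \<and> (\<forall>z\<in>topspace X. 0 \<le> f z) \<and>
    (\<exists>U\<in>\<U>. \<forall>z\<in>topspace X - U. f z = 1)}"
  define below where "below f = {g \<in> points ?\<xi>. \<forall>z\<in>topspace X. 0 \<le> g z \<and> g z \<le> f z}"
    for f :: "'a \<Rightarrow> real"
  define F where "F = generated_filter (insert (points ?\<xi>) (below ` \<Phi>))"
  have "?zero \<in> \<Inter>(insert (points ?\<xi>) (below ` \<Phi>))"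
    using zero by (auto simp: below_def \<Phi>_def)
  then have "filter_on (points ?\<xi>) F"
    unfolding F_def by (rule filter_on_generated_filter) simp
  moreover have "?zero \<in> lims ?\<xi> F"
    unfolding in_lims_real_maps_convergence
  proof (intro conjI ballI allI impI zero)
    fix x W assume x: "x \<in> topspace X" and W: "open W \<and> ?zero x \<in> W"
    then obtain e where e: "e > 0" "ball 0 e \<subseteq> W"
      using open_contains_ball[of W] by auto
    obtain U where U: "U \<in> \<U>" "x \<in> U"
      using x \<U>(2) by blast
    obtain f where f: "continuous_map X euclideanreal f" "f x = 0"
        "\<And>z. z \<in> topspace X \<Longrightarrow> 0 \<le> f z" "\<And>z. z \<in> topspace X - U \<Longrightarrow> f z = 1"
      using separating_function[OF X \<U>(1)[OF U(1)] U(2)] by metis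
    let ?V = "{z \<in> topspace X. f z \<in> {..<e}}"
    have "openin X ?V"
      using f(1) by (rule openin_continuous_map_preimage) simp
    moreover have "x \<in> ?V"
      using x e(1) f(2) by simp
    moreover have "in_filter (below f) F"
    proof -
      have "f \<in> \<Phi>"
        using f U(1) unfolding \<Phi>_def by blast
      then show ?thesis
        unfolding F_def by (intro in_generated_filterI[of "below f"]) auto
    qed
    moreover have "g ` ?V \<subseteq> W" if g: "g \<in> below f" for g
    proof
      fix r assume "r \<in> g ` ?V"
      then have "0 \<le> r" "r < e"
        using g by (fastforce simp: below_def)+
      then show "r \<in> W"
        using e(2) by (auto simp: dist_real_def)
    qed
    ultimately show "\<exists>V A. openin X V \<and> x \<in> V \<and> in_filter A F \<and> (\<forall>g\<in>A. g ` V \<subseteq> W)"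
      by blast
  qed
  moreover have "\<exists>p\<in>A \<inter> points ?\<xi>. \<exists>\<E>\<subseteq>\<U>. finite \<E> \<and> {x \<in> topspace X. p x < 1} \<subseteq> \<Union>\<E>"
    if A: "in_filter A F" for A
  proof -
    obtain \<H> where \<H>: "\<H> \<subseteq> insert (points ?\<xi>) (below ` \<Phi>)" "finite \<H>" "\<Inter>\<H> \<subseteq> A"
      using A unfolding F_def in_generated_filter by blast
    then have "finite (\<H> \<inter> below ` \<Phi>)" by simp
    then obtain \<Psi> where \<Psi>: "\<Psi> \<subseteq> \<Phi>" "finite \<Psi>" "\<H> \<inter> below ` \<Phi> = below ` \<Psi>"
      using finite_subset_image[of "\<H> \<inter> below ` \<Phi>" below \<Phi>] by auto
    \<comment> \<open>\<open>h\<close> is the pointwise minimum of \<open>1\<close> and \<open>\<Psi>\<close>; the \<open>1\<close> accounts for \<open>\<Psi> = {}\<close>.\<close>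
    have "\<exists>h. continuous_map X euclideanreal h \<and>
        (\<forall>z\<in>topspace X. 0 \<le> h z \<and> (\<forall>f\<in>\<Psi>. h z \<le> f z)) \<and>
        (\<exists>\<E>\<subseteq>\<U>. finite \<E> \<and> (\<forall>z\<in>topspace X - \<Union>\<E>. 1 \<le> h z))"
      using \<Psi>(2,1)
    proof (induction rule: finite_induct)
      case empty
      show ?case
        by (intro exI[of _ "\<lambda>_. 1"] conjI exI[of _ "{}"]) simp_all
    next
      case (insert f \<Psi>)
      then obtain h \<E> where h: "continuous_map X euclideanreal h"
          "\<And>z. z \<in> topspace X \<Longrightarrow> 0 \<le> h z \<and> (\<forall>f\<in>\<Psi>. h z \<le> f z)"
          "\<E> \<subseteq> \<U>" "finite \<E>" "\<And>z. z \<in> topspace X - \<Union>\<E> \<Longrightarrow> 1 \<le> h z"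
        by auto
      obtain U where f: "continuous_map X euclideanreal f" "\<And>z. z \<in> topspace X \<Longrightarrow> 0 \<le> f z"
          "U \<in> \<U>" "\<And>z. z \<in> topspace X - U \<Longrightarrow> f z = 1"
        using insert.prems unfolding \<Phi>_def by blast
      let ?h = "\<lambda>z. min (f z) (h z)"
      have "continuous_map X euclideanreal ?h"
        using f(1) h(1) by (rule continuous_map_real_min)
      moreover have "0 \<le> ?h z \<and> (\<forall>g\<in>insert f \<Psi>. ?h z \<le> g z)" if "z \<in> topspace X" for z
        using f(2)[OF that] h(2)[OF that] by (auto simp: min.coboundedI2)
      moreover have "1 \<le> ?h z" if "z \<in> topspace X - \<Union>(insert U \<E>)" for z
        using f(4)[of z] h(5)[of z] that by auto
      ultimately show ?case
        using h(3,4) f(3)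
        by (intro exI[of _ ?h] conjI ballI exI[of _ "insert U \<E>"]) auto
    qed
    then obtain h \<E> where h: "continuous_map X euclideanreal h"
        "\<And>z. z \<in> topspace X \<Longrightarrow> 0 \<le> h z \<and> (\<forall>f\<in>\<Psi>. h z \<le> f z)"
        and \<E>: "\<E> \<subseteq> \<U>" "finite \<E>" "\<And>z. z \<in> topspace X - \<Union>\<E> \<Longrightarrow> 1 \<le> h z"
      by auto
    let ?h = "restrict h (topspace X)"
    have point: "?h \<in> points ?\<xi>"
      using h(1) by (rule restrict_in_points_real_maps_convergence)
    moreover have "?h \<in> G" if G: "G \<in> \<H>" for G
    proof (cases "G = points ?\<xi>")
      case False
      then have "G \<in> below ` \<Psi>"
        using G \<H>(1) \<Psi>(3) by blast
      then show ?thesis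
        using point h(2) by (auto simp: below_def)
    qed (use point in simp)
    ultimately have "?h \<in> A \<inter> points ?\<xi>"
      using \<H>(3) by blast
    moreover have "{x \<in> topspace X. ?h x < 1} \<subseteq> \<Union>\<E>"
    proof (rule subsetI, rule ccontr)
      fix x assume x: "x \<in> {x \<in> topspace X. ?h x < 1}" "x \<notin> \<Union>\<E>"
      then show False
        using \<E>(3)[of x] by auto
    qed
    ultimately show ?thesis
      using \<E>(1,2) by (intro bexI[of _ ?h] exI[of _ \<E>] conjI)
  qed
  ultimately show "\<exists>F. filter_on (points ?\<xi>) F \<and> ?zero \<in> lims ?\<xi> F \<and> (\<forall>A. in_filter A F \<longrightarrow>
      (\<exists>p\<in>A \<inter> points ?\<xi>. \<exists>\<E>\<subseteq>\<U>. finite \<E> \<and> {x \<in> topspace X. p x < 1} \<subseteq> \<Union>\<E>))"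
    by (intro exI[of _ F] conjI allI impI)
next
  let ?\<xi> = "real_maps_convergence X" and ?zero = "restrict (\<lambda>_. 0 :: real) (topspace X)"
  fix D x assume D: "?zero \<in> lims ?\<xi> D" and x: "x \<in> topspace X"
  have "open {..<1 :: real} \<and> ?zero x \<in> {..<1}"
    using x by simp
  then obtain V A where "x \<in> V" "in_filter A D" "\<And>g. g \<in> A \<Longrightarrow> g ` V \<subseteq> {..<1}"
    using D x unfolding in_lims_real_maps_convergence by meson
  then show "in_filter {g. x \<in> {x \<in> topspace X. g x < 1}} D"
    using x by (elim in_filter_mono) auto
qed

section \<open>Equality of the cardinal functions\<close>

lemma lindelof_le_iff_open_sets:
  fixes X :: "'a topology"
  assumes "Cinfinite \<kappa>"
  shows "character_at_le (open_sets_convergence X) (topspace X) \<kappa> \<longleftrightarrow> lindelof_le X \<kappa>"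
    and "tightness_at_le (open_sets_convergence X) (topspace X) \<kappa> \<longleftrightarrow> lindelof_le X \<kappa>"
proof -
  let ?\<O> = "open_sets_convergence X"
  note conv = is_convergence_open_sets_convergence[of X]
  have "character_at_le ?\<O> (topspace X) \<kappa>" if "lindelof_le X \<kappa>"
    using assms lindelof_subset_topspace[OF that] by (rule character_open_sets_le_if_lindelof_le)
  moreover have "tightness_at_le ?\<O> (topspace X) \<kappa>" if "character_at_le ?\<O> (topspace X) \<kappa>"
    using assms that by (rule tightness_at_le_if_character_at_le)
  moreover have "lindelof_le X \<kappa>" if "tightness_at_le ?\<O> (topspace X) \<kappa>"
    using assms that
  proof (rule lindelof_le_if_tightness_open_sets)
    show "lims ?\<O> F \<subseteq> lims (T_mod ?\<O>) F" if "filter_on {U. openin X U} F" for F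
      using lims_subset_lims_T_mod[OF conv] that by simp
  qed simp_all
  ultimately show "character_at_le ?\<O> (topspace X) \<kappa> \<longleftrightarrow> lindelof_le X \<kappa>"
      "tightness_at_le ?\<O> (topspace X) \<kappa> \<longleftrightarrow> lindelof_le X \<kappa>"
    by argo+
qed

lemma lindelof_le_iff_T_mod:
  fixes X :: "'a topology"
  assumes \<kappa>: "Cinfinite \<kappa>" and X: "completely_regular_space X"
  shows "tightness_at_le (T_mod (open_sets_convergence X)) (topspace X) \<kappa> \<longleftrightarrow> lindelof_le X \<kappa>"
proof
  let ?\<O> = "open_sets_convergence X"
  note conv = is_convergence_open_sets_convergence[of X]
  assume "tightness_at_le (T_mod ?\<O>) (topspace X) \<kappa>"
  with \<kappa> show "lindelof_le X \<kappa>"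
  proof (rule lindelof_le_if_tightness_open_sets)
    show "lims ?\<O> F \<subseteq> lims (T_mod ?\<O>) F" if "filter_on {U. openin X U} F" for F
      using lims_subset_lims_T_mod[OF conv] that by simp
  qed (simp_all add: points_T_mod[OF conv])
next
  let ?\<O> = "open_sets_convergence X"
  assume L: "lindelof_le X \<kappa>"
  show "tightness_at_le (T_mod ?\<O>) (topspace X) \<kappa>"
  proof (rule tightness_at_le_T_mod[OF \<kappa> is_convergence_open_sets_convergence])
    fix \<B> assume "\<B> \<subseteq> points ?\<O>"
      "\<And>W. modification_open ?\<O> W \<Longrightarrow> topspace X \<in> W \<Longrightarrow> W \<inter> \<B> \<noteq> {}"
    then show "\<exists>A\<subseteq>\<B>. |A| \<le>o \<kappa> \<and>
        (\<forall>W. modification_open ?\<O> W \<and> topspace X \<in> W \<longrightarrow> W \<inter> A \<noteq> {})"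
      unfolding points_open_sets_convergence
      by (rule small_subset_with_topspace_in_closure[OF \<kappa> X lindelof_subset_topspace[OF L]])
  qed
qed

lemma lindelof_le_iff_real_maps:
  fixes X :: "'a topology"
  assumes \<kappa>: "Cinfinite \<kappa>" and X: "completely_regular_space X"
  shows "(\<forall>f\<in>points (real_maps_convergence X). character_at_le (real_maps_convergence X) f \<kappa>) \<longleftrightarrow>
      lindelof_le X \<kappa>"
    and "(\<forall>f\<in>points (real_maps_convergence X). tightness_at_le (real_maps_convergence X) f \<kappa>) \<longleftrightarrow>
      lindelof_le X \<kappa>"
proof -
  let ?\<R> = "real_maps_convergence X"
  have "\<forall>f\<in>points ?\<R>. character_at_le ?\<R> f \<kappa>" if "lindelof_le X \<kappa>"
    using character_real_maps_le_if_lindelof_le[OF \<kappa> lindelof_subset_topspace[OF that]] by simp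
  moreover have "\<forall>f\<in>points ?\<R>. tightness_at_le ?\<R> f \<kappa>"
    if "\<forall>f\<in>points ?\<R>. character_at_le ?\<R> f \<kappa>"
    by (intro ballI tightness_at_le_if_character_at_le[OF \<kappa>] bspec[OF that])
  moreover have "lindelof_le X \<kappa>" if tight: "\<forall>f\<in>points ?\<R>. tightness_at_le ?\<R> f \<kappa>"
  proof -
    have "restrict (\<lambda>_. 0) (topspace X) \<in> points ?\<R>"
      by (intro restrict_in_points_real_maps_convergence) simp
    then show ?thesis
      by (intro lindelof_le_if_tightness_real_maps[OF \<kappa> X] bspec[OF tight])
  qed
  ultimately show "(\<forall>f\<in>points ?\<R>. character_at_le ?\<R> f \<kappa>) \<longleftrightarrow> lindelof_le X \<kappa>"
      "(\<forall>f\<in>points ?\<R>. tightness_at_le ?\<R> f \<kappa>) \<longleftrightarrow> lindelof_le X \<kappa>"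
    by argo+
qed

lemma ordIso_lindelof_degree:
  fixes X :: "'a topology" and \<alpha> :: "'c rel"
  assumes \<alpha>: "Cinfinite \<alpha>"
    and self: "\<alpha> \<le>o \<alpha> \<longleftrightarrow> lindelof_le X \<alpha>"
    and bound: "\<And>\<kappa> :: ('a set + nat) rel. Cinfinite \<kappa> \<Longrightarrow> \<alpha> \<le>o \<kappa> \<longleftrightarrow> lindelof_le X \<kappa>"
  shows "lindelof_degree X =o \<alpha>"
proof -
  have L: "Cinfinite (lindelof_degree X)" "lindelof_le X (lindelof_degree X)"
    using lindelof_degree_is_least[of X] by (simp_all add: is_least_card_def)
  have "lindelof_le X \<alpha>"
    using self \<alpha> by (auto intro: ordLeq_refl)
  then have "lindelof_degree X \<le>o \<alpha>"
    using lindelof_degree_ordLeq_iff[OF \<alpha>, of X] by simp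
  moreover have "\<alpha> \<le>o lindelof_degree X"
    using bound[OF L(1)] L(2) by simp
  ultimately show ?thesis
    by (simp add: ordIso_iff_ordLeq)
qed

theorem corollary9p8:
  fixes X :: "'a topology"
  assumes "completely_regular_space X"
  shows "lindelof_degree X =o character_at (open_sets_convergence X) (topspace X) \<and>
    character_at (open_sets_convergence X) (topspace X)
      =o tightness_at (open_sets_convergence X) (topspace X) \<and>
    tightness_at (open_sets_convergence X) (topspace X)
      =o tightness_at (T_mod (open_sets_convergence X)) (topspace X) \<and>
    tightness_at (T_mod (open_sets_convergence X)) (topspace X)
      =o character (real_maps_convergence X) \<and>
    character (real_maps_convergence X) =o tightness (real_maps_convergence X)"
proof -
  let ?\<O> = "open_sets_convergence X" and ?\<R> = "real_maps_convergence X"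
  have inf: "Cinfinite (character_at ?\<O> (topspace X))" "Cinfinite (tightness_at ?\<O> (topspace X))"
      "Cinfinite (tightness_at (T_mod ?\<O>) (topspace X))"
      "Cinfinite (character ?\<R>)" "Cinfinite (tightness ?\<R>)"
    using character_at_is_least[of ?\<O> "topspace X"] tightness_at_is_least[of ?\<O> "topspace X"]
      tightness_at_is_least[of "T_mod ?\<O>" "topspace X"]
      character_is_least[of ?\<R>] tightness_is_least[of ?\<R>]
    by (simp_all only: is_least_card_def)
  note bounds = character_at_ordLeq_iff tightness_at_ordLeq_iff character_ordLeq_iff
    tightness_ordLeq_iff lindelof_le_iff_open_sets lindelof_le_iff_T_mod[OF _ assms]
    lindelof_le_iff_real_maps[OF _ assms]
  have iso: "lindelof_degree X =o character_at ?\<O> (topspace X)"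
      "lindelof_degree X =o tightness_at ?\<O> (topspace X)"
      "lindelof_degree X =o tightness_at (T_mod ?\<O>) (topspace X)"
      "lindelof_degree X =o character ?\<R>" "lindelof_degree X =o tightness ?\<R>"
    by (rule ordIso_lindelof_degree; simp only: bounds inf)+
  show ?thesis
    by (intro conjI iso(1) iso[THEN ordIso_symmetric, THEN ordIso_transitive] iso(2-))
qed

end
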